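(* Let $P_1,\ldots,P_q$ be finite posets, each $P_i$ decomposed into two disjoint chains $a^{(i)}_1<\cdots<a^{(i)}_{p_i}$ and $b^{(i)}_1<\cdots<b^{(i)}_{q_i}$ with $p_i,q_i\ge1$ (elements of different chains of the same $P_i$ may be comparable). With the ring $K[\{x_\alpha\}_\alpha]$, the monomial order $<_{\rm rev}$, the linear polynomials $\theta_0$ and $\theta_c$ ($c\in P_1\sqcup\cdots\sqcup P_q$), the monomial ideal $\mathrm{in}_{<_{\rm rev}}(I_{\mathcal{O}(P_1,\ldots,P_q)})$ and the sets of monomials $\mathcal{S}_i$ defined in the context, let $$J=\big(\mathrm{in}_{<_{\rm rev}}(I_{\mathcal{O}(P_1,\ldots,P_q)}),\ \theta_0,\ \{\theta_c\}_{c\in P_1\sqcup\cdots\sqcup P_q}\big).$$ Then the set of standard monomials of the residue class ring $K[\{x_\alpha\}_\alpha]/\mathrm{in}_{<_{\rm rev}}(J)$ with respect to $<_{\rm rev}$ (the monomials not belonging to $\mathrm{in}_{<_{\rm rev}}(J)$) coincides with the set of square-free monomials $$\Big\{\prod_{i=1}^qu_i\ :\ u_i\in\mathcal{S}_i,\ 1\le i\le q\Big\}.$$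
   Context: For a finite poset $Q$, a poset ideal is a subset $\alpha\subseteq Q$ such that $a\in\alpha$, $b\le a$ imply $b\in\alpha$. $\mathcal{J}(Q)$ is the lattice of poset ideals ordered by inclusion. The underlying sets of $P_1,\ldots,P_q$ are regarded as pairwise disjoint, and the bouquet is $\mathcal{B}=\bigcup_{i=1}^q\mathcal{J}(P_i)$, in which the empty ideals of all the $P_i$ are identified (so $\mathcal{J}(P_i)\cap\mathcal{J}(P_{i'})=\{\emptyset\}$ for $i\neq i'$). $K$ is the rational function field over $\mathbf{C}$ in indeterminates $\xi_\alpha$ ($\alpha\in\mathcal{B}$), $\eta_c$ ($c\in P_1\sqcup\cdots\sqcup P_q$) and $\eta_0$. $K[\{x_\alpha\}_\alpha]$ is the polynomial ring over $K$ in variables $x_\alpha$, $\alpha\in\mathcal{B}$. Set $$\theta_c=\sum_{\alpha\in\mathcal{B},\ c\in\alpha}\xi_\alpha x_\alpha-\eta_c,\qquad \theta_0=\sum_{\alpha\in\mathcal{B}}\xi_\alpha x_\alpha-\eta_0 .$$ Fix any total ordering of the variables such that $x_\alpha<x_\beta$ whenever $\alpha,\beta\in\mathcal{J}(P_i)$ for some $i$ and $\alpha\supsetneq\beta$. $<_{\rm rev}$ is the induced (graded) reverse lexicographic order. $I_{\mathcal{O}(P_1,\ldots,P_q)}$ is the toric ideal, i.e. the kernel of the $K$-algebra map $x_\alpha\mapsto(\prod_{c\in\alpha}t_c)\,\sigma$ into the polynomial ring $K[\{t_c\},\sigma]$. Its initial ideal with respect to $<_{\rm rev}$ is generated by the monomials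 $x_\alpha x_\beta$ such that $\alpha,\beta$ belong to $\mathcal{J}(P_i)$ for some $i$ and are incomparable in $\mathcal{J}(P_i)$. Definition of $\mathcal{S}_i$: let $\mathcal{A}_i$ be the set of pairs $(k,\ell)$, $0\le k\le p_i$, $0\le\ell\le q_i$, such that $\alpha^{(i)}_{k,\ell}=\{a^{(i)}_1,\ldots,a^{(i)}_k,b^{(i)}_1,\ldots,b^{(i)}_\ell\}$ is a poset ideal of $P_i$, and write $x^{(i)}_{k,\ell}=x_{\alpha^{(i)}_{k,\ell}}$. For $0\le k\le p_i$ let $\ell^\sharp_k$ be the smallest integer with $(k,\ell^\sharp_k)\in\mathcal{A}_i$. For $0\le\ell\le q_i$ let $k^\flat_\ell$ be the smallest integer with $(k^\flat_\ell,\ell)\in\mathcal{A}_i$. Then $\mathcal{S}_i$ is the set of monomials $x^{(i)}_{k_1,\ell_1}\cdots x^{(i)}_{k_r,\ell_r}$, $r=0,1,2,\ldots$, with each $(k_h,\ell_h)\in\mathcal{A}_i\setminus(\{(k,\ell^\sharp_k):0\le k\le p_i\}\cup\{(k^\flat_\ell,\ell):0\le\ell\le q_i\})$, $0<k_1<\cdots<k_r\le p_i$ and $0<\ell_1<\cdots<\ell_r\le q_i$. *)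

theory Defs
  imports
    "HOL-Library.Poly_Mapping"
    "HOL-Library.Disjoint_Sets"
    "HOL-Computational_Algebra.Fraction_Field"
    Complex_Main
begin

section \<open>Multivariate polynomials over a set of variables\<close>

type_synonym ('v, 'k) mpoly = "('v \<Rightarrow>\<^sub>0 nat) \<Rightarrow>\<^sub>0 'k"

definition Const :: "'k::zero \<Rightarrow> ('v, 'k) mpoly" where
  "Const c = Poly_Mapping.single 0 c"

definition Var :: "'v \<Rightarrow> ('v, 'k::{zero,one}) mpoly" where
  "Var v = Poly_Mapping.single (Poly_Mapping.single v 1) 1"

text \<open>The type \<open>('v, 'k) mpoly\<close> has a variable for every element of \<open>'v\<close>;
  \<open>poly_ring X\<close> is the subring \<open>k[x\<^sub>v : v \<in> X]\<close>.\<close>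

definition poly_ring :: "'v set \<Rightarrow> ('v, 'k::zero) mpoly set" where
  "poly_ring X = {f. \<forall>m\<in>Poly_Mapping.keys f. Poly_Mapping.keys m \<subseteq> X}"

definition monomials :: "'v set \<Rightarrow> ('v, 'k::{zero,one}) mpoly set" where
  "monomials X = {Poly_Mapping.single m 1 |m. Poly_Mapping.keys m \<subseteq> X}"

definition squarefree_monomials :: "'v set \<Rightarrow> ('v, 'k::comm_semiring_1) mpoly set" where
  "squarefree_monomials X = {\<Prod>v\<in>A. Var v |A. finite A \<and> A \<subseteq> X}"

definition eval_mpoly ::
    "('k::zero \<Rightarrow> 'r::comm_semiring_1) \<Rightarrow> ('v \<Rightarrow> 'r) \<Rightarrow> ('v, 'k) mpoly \<Rightarrow> 'r" where
  "eval_mpoly \<phi> g f =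
     (\<Sum>m\<in>Poly_Mapping.keys f. \<phi> (Poly_Mapping.lookup f m) *
        (\<Prod>v\<in>Poly_Mapping.keys m. g v ^ Poly_Mapping.lookup m v))"

text \<open>The ideal of the subring \<open>R\<close> generated by \<open>G\<close> (for \<open>G \<subseteq> R\<close>).\<close>

definition ideal_gen :: "'r::comm_ring_1 set \<Rightarrow> 'r set \<Rightarrow> 'r set" where
  "ideal_gen R G = {\<Sum>g\<in>F. h g * g |F h. finite F \<and> F \<subseteq> G \<and> (\<forall>g\<in>F. h g \<in> R)}"


section \<open>Rational function fields\<close>

text \<open>\<open>rational_function_field \<iota> X g\<close>: the field \<open>'k\<close>, viewed as an extension of \<open>'c\<close> via the
  embedding \<open>\<iota>\<close>, is the field of rational functions over \<open>'c\<close> in the indeterminates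
  \<open>g v\<close>, \<open>v \<in> X\<close>.  That is, evaluation at \<open>g\<close> embeds the polynomial ring in the variables \<open>X\<close>
  into \<open>'k\<close>, and \<open>'k\<close> is the field of fractions of the image.\<close>

definition rational_function_field ::
    "('c::field \<Rightarrow> 'k::field) \<Rightarrow> 'v set \<Rightarrow> ('v \<Rightarrow> 'k) \<Rightarrow> bool" where
  "rational_function_field \<iota> X g \<longleftrightarrow>
     \<iota> 1 = 1 \<and> (\<forall>x y. \<iota> (x + y) = \<iota> x + \<iota> y) \<and> (\<forall>x y. \<iota> (x * y) = \<iota> x * \<iota> y) \<and>
     (\<forall>f\<in>poly_ring X. eval_mpoly \<iota> g f = 0 \<longrightarrow> f = 0) \<and>
     (\<forall>z. \<exists>f\<in>poly_ring X. \<exists>h\<in>poly_ring X. h \<noteq> 0 \<and> z = eval_mpoly \<iota> g f / eval_mpoly \<iota> g h)"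


section \<open>Initial ideals\<close>

definition deg_mon :: "('v \<Rightarrow>\<^sub>0 nat) \<Rightarrow> nat" where
  "deg_mon m = (\<Sum>v\<in>Poly_Mapping.keys m. Poly_Mapping.lookup m v)"

text \<open>Graded reverse lexicographic order \<open>m < n\<close> on exponent vectors, where \<open>(w, v) \<in> lt\<close>
  means \<open>x\<^sub>w < x\<^sub>v\<close>: for equal degrees, the smallest variable in which \<open>m\<close> and \<open>n\<close>
  differ has the larger exponent in \<open>m\<close>.\<close>

definition grevlex_less :: "'v rel \<Rightarrow> ('v \<Rightarrow>\<^sub>0 nat) \<Rightarrow> ('v \<Rightarrow>\<^sub>0 nat) \<Rightarrow> bool" where
  "grevlex_less lt m n \<longleftrightarrow>
     deg_mon m < deg_mon n \<or>
     deg_mon m = deg_mon n \<and>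
       (\<exists>v. Poly_Mapping.lookup n v < Poly_Mapping.lookup m v \<and>
            (\<forall>w. (w, v) \<in> lt \<longrightarrow> Poly_Mapping.lookup m w = Poly_Mapping.lookup n w))"

definition is_initial_exponent :: "'v rel \<Rightarrow> ('v, 'k::zero) mpoly \<Rightarrow> ('v \<Rightarrow>\<^sub>0 nat) \<Rightarrow> bool" where
  "is_initial_exponent lt f m \<longleftrightarrow>
     m \<in> Poly_Mapping.keys f \<and> (\<forall>n\<in>Poly_Mapping.keys f. n \<noteq> m \<longrightarrow> grevlex_less lt n m)"

definition initial_ideal ::
    "'v set \<Rightarrow> 'v rel \<Rightarrow> ('v, 'k::field) mpoly set \<Rightarrow> ('v, 'k) mpoly set" where
  "initial_ideal X lt I =
     ideal_gen (poly_ring X) {Poly_Mapping.single m 1 |m. \<exists>f\<in>I. is_initial_exponent lt f m}"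

definition standard_monomials ::
    "'v set \<Rightarrow> 'v rel \<Rightarrow> ('v, 'k::field) mpoly set \<Rightarrow> ('v, 'k) mpoly set" where
  "standard_monomials X lt I = monomials X - initial_ideal X lt I"


section \<open>Poset ideals and the bouquet\<close>

definition poset_ideals :: "'a set \<Rightarrow> 'a rel \<Rightarrow> 'a set set" where
  "poset_ideals P r = {\<alpha>. \<alpha> \<subseteq> P \<and> (\<forall>x\<in>\<alpha>. \<forall>y\<in>P. (y, x) \<in> r \<longrightarrow> y \<in> \<alpha>)}"

text \<open>The posets \<open>P 1, \<dots>, P q\<close> are pairwise disjoint subsets of one type, so their empty
  ideals are the same set.\<close>

definition bouquet :: "nat \<Rightarrow> (nat \<Rightarrow> 'a set) \<Rightarrow> (nat \<Rightarrow> 'a rel) \<Rightarrow> 'a set set" where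
  "bouquet q P r = (\<Union>i\<in>{1..q}. poset_ideals (P i) (r i))"

definition two_chains ::
    "'a set \<Rightarrow> 'a rel \<Rightarrow> nat \<Rightarrow> (nat \<Rightarrow> 'a) \<Rightarrow> nat \<Rightarrow> (nat \<Rightarrow> 'a) \<Rightarrow> bool" where
  "two_chains P r m a n b \<longleftrightarrow>
     P = a ` {1..m} \<union> b ` {1..n} \<and> a ` {1..m} \<inter> b ` {1..n} = {} \<and>
     (\<forall>j\<in>{1..m}. \<forall>k\<in>{1..m}. j < k \<longrightarrow> (a j, a k) \<in> r \<and> a j \<noteq> a k) \<and>
     (\<forall>j\<in>{1..n}. \<forall>k\<in>{1..n}. j < k \<longrightarrow> (b j, b k) \<in> r \<and> b j \<noteq> b k)"

datatype 'a indet = Xi "'a set" | Eta 'a | Eta0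

definition indets :: "'a set set \<Rightarrow> 'a set \<Rightarrow> 'a indet set" where
  "indets B C = Xi ` B \<union> Eta ` C \<union> {Eta0}"

datatype 'a tvar = T_of 'a | T_sigma

definition toric_ideal :: "'a set set \<Rightarrow> ('a set, 'k::field) mpoly set" where
  "toric_ideal B =
     {f \<in> poly_ring B.
        eval_mpoly Const (\<lambda>\<alpha>. (\<Prod>c\<in>\<alpha>. Var (T_of c)) * Var T_sigma :: ('a tvar, 'k) mpoly) f = 0}"

definition theta ::
    "'a set set \<Rightarrow> ('a set \<Rightarrow> 'k::field) \<Rightarrow> ('a \<Rightarrow> 'k) \<Rightarrow> 'a \<Rightarrow> ('a set, 'k) mpoly" where
  "theta B \<xi> \<eta> c = (\<Sum>\<alpha> | \<alpha> \<in> B \<and> c \<in> \<alpha>. Const (\<xi> \<alpha>) * Var \<alpha>) - Const (\<eta> c)"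

definition theta0 ::
    "'a set set \<Rightarrow> ('a set \<Rightarrow> 'k::field) \<Rightarrow> 'k \<Rightarrow> ('a set, 'k) mpoly" where
  "theta0 B \<xi> \<eta>0 = (\<Sum>\<alpha>\<in>B. Const (\<xi> \<alpha>) * Var \<alpha>) - Const \<eta>0"

definition J_ideal ::
    "'a set set \<Rightarrow> 'a set \<Rightarrow> 'a set rel \<Rightarrow> ('a set \<Rightarrow> 'k::field) \<Rightarrow> ('a \<Rightarrow> 'k) \<Rightarrow> 'k
       \<Rightarrow> ('a set, 'k) mpoly set" where
  "J_ideal B C lt \<xi> \<eta> \<eta>0 =
     ideal_gen (poly_ring B)
       (initial_ideal B lt (toric_ideal B) \<union> {theta0 B \<xi> \<eta>0} \<union> theta B \<xi> \<eta> ` C)"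


section \<open>The sets of monomials attached to a two-chain poset\<close>

definition alpha :: "(nat \<Rightarrow> 'a) \<Rightarrow> (nat \<Rightarrow> 'a) \<Rightarrow> nat \<Rightarrow> nat \<Rightarrow> 'a set" where
  "alpha a b k l = a ` {1..k} \<union> b ` {1..l}"

definition ideal_pairs ::
    "'a set \<Rightarrow> 'a rel \<Rightarrow> nat \<Rightarrow> (nat \<Rightarrow> 'a) \<Rightarrow> nat \<Rightarrow> (nat \<Rightarrow> 'a) \<Rightarrow> (nat \<times> nat) set" where
  "ideal_pairs P r m a n b =
     {(k, l). k \<le> m \<and> l \<le> n \<and> alpha a b k l \<in> poset_ideals P r}"

definition l_sharp :: "(nat \<times> nat) set \<Rightarrow> nat \<Rightarrow> nat" where
  "l_sharp A k = (LEAST l. (k, l) \<in> A)"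

definition k_flat :: "(nat \<times> nat) set \<Rightarrow> nat \<Rightarrow> nat" where
  "k_flat A l = (LEAST k. (k, l) \<in> A)"

definition S_pairs ::
    "'a set \<Rightarrow> 'a rel \<Rightarrow> nat \<Rightarrow> (nat \<Rightarrow> 'a) \<Rightarrow> nat \<Rightarrow> (nat \<Rightarrow> 'a) \<Rightarrow> (nat \<times> nat) set" where
  "S_pairs P r m a n b =
     (let A = ideal_pairs P r m a n b
      in A - ({(k, l_sharp A k) |k. k \<le> m} \<union> {(k_flat A l, l) |l. l \<le> n}))"

definition S_monomials ::
    "'a set \<Rightarrow> 'a rel \<Rightarrow> nat \<Rightarrow> (nat \<Rightarrow> 'a) \<Rightarrow> nat \<Rightarrow> (nat \<Rightarrow> 'a)
       \<Rightarrow> ('a set, 'k::comm_semiring_1) mpoly set" where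
  "S_monomials P r m a n b =
     {\<Prod>h\<in>{1..d}. Var (alpha a b (k h) (l h)) |(d::nat) k l.
        (\<forall>h\<in>{1..d}. (k h, l h) \<in> S_pairs P r m a n b \<and> 0 < k h \<and> k h \<le> m \<and> 0 < l h \<and> l h \<le> n) \<and>
        strict_mono_on {1..d} k \<and> strict_mono_on {1..d} l}"


section \<open>The fraction field of a polynomial ring is a rational function field\<close>

lemma lookup_mpoly_sum:
  "f = (\<Sum>m\<in>Poly_Mapping.keys f. Poly_Mapping.single m (Poly_Mapping.lookup f m))"
  by (rule poly_mapping_eqI)
    (simp add: lookup_sum lookup_single when_def sum.delta' in_keys_iff)

lemma Var_power: "Var v ^ n = (Poly_Mapping.single (Poly_Mapping.single v n) 1 :: ('v, 'k::comm_semiring_1) mpoly)"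
proof (induction n)
  case (Suc n)
  then show ?case
    by (simp add: Var_def mult_single single_add[symmetric])
qed simp

lemma prod_single_one:
  "finite A \<Longrightarrow> (\<Prod>v\<in>A. Poly_Mapping.single (e v) (1::'k::comm_semiring_1)) =
     Poly_Mapping.single (\<Sum>v\<in>A. e v :: 'v \<Rightarrow>\<^sub>0 nat) 1"
  by (induction A rule: finite_induct) (simp_all add: mult_single)

lemma eval_mpoly_Const_Var: "eval_mpoly Const Var f = (f :: ('v, 'k::comm_semiring_1) mpoly)"
proof -
  have "(\<Prod>v\<in>Poly_Mapping.keys m. Var v ^ Poly_Mapping.lookup m v) =
      (Poly_Mapping.single m 1 :: ('v, 'k) mpoly)" for m
    by (simp add: Var_power prod_single_one lookup_mpoly_sum[symmetric])
  then have "eval_mpoly Const Var f =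
      (\<Sum>m\<in>Poly_Mapping.keys f. Poly_Mapping.single m (Poly_Mapping.lookup f m))"
    by (simp add: eval_mpoly_def Const_def mult_single)
  then show ?thesis
    by (simp add: lookup_mpoly_sum[symmetric])
qed

lemma rational_function_field_fract:
  "rational_function_field
     (\<lambda>c. Fraction_Field.Fract (Const c) 1 :: ('v::linorder, 'c::field) mpoly fract) UNIV (\<lambda>v. Fraction_Field.Fract (Var v) 1)"
proof -
  let ?F = "\<lambda>f :: ('v, 'c) mpoly. Fraction_Field.Fract f 1"
  have one: "?F 1 = 1" by (simp add: One_fract_def)
  have zero: "?F 0 = 0" by (simp add: Zero_fract_def)
  have add: "?F (f + g) = ?F f + ?F g" and mult: "?F (f * g) = ?F f * ?F g" for f g
    by simp_all
  have sum: "?F (\<Sum>x\<in>A. u x) = (\<Sum>x\<in>A. ?F (u x))" for A :: "('v \<Rightarrow>\<^sub>0 nat) set" and u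
    by (induction A rule: infinite_finite_induct) (simp_all only: sum.empty sum.insert sum.infinite zero add not_False_eq_True)
  have prod: "?F (\<Prod>x\<in>A. u x) = (\<Prod>x\<in>A. ?F (u x))" for A :: "'v set" and u
    by (induction A rule: infinite_finite_induct) (simp_all only: prod.empty prod.insert prod.infinite one mult not_False_eq_True)
  have pow: "?F (f ^ n) = ?F f ^ n" for f n
    by (induction n) (simp_all only: power.simps one mult)
  have eval: "eval_mpoly (\<lambda>c. ?F (Const c)) (\<lambda>v. ?F (Var v)) f = ?F f" for f
  proof -
    have "?F f = ?F (eval_mpoly Const Var f)"
      by (simp only: eval_mpoly_Const_Var)
    also have "\<dots> = eval_mpoly (\<lambda>c. ?F (Const c)) (\<lambda>v. ?F (Var v)) f"
      by (simp only: eval_mpoly_def sum mult prod pow)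
    finally show ?thesis ..
  qed
  have "\<exists>f h. h \<noteq> 0 \<and> z = ?F f / ?F h" for z
    by (cases z) (auto intro!: exI)
  then show ?thesis
    unfolding rational_function_field_def eval
    by (auto simp: poly_ring_def one Const_def single_add mult_single
        Zero_fract_def eq_fract simp flip: one)
qed

end

theory Submission
  imports Defs "HOL-Library.Function_Algebras"
begin

text \<open>
  By the choice of the variable order, the initial variable of \<open>theta c\<close> is the principal ideal of \<open>c\<close>
  and that of \<open>theta0\<close> is the empty ideal; these are exactly the ideals excluded from \<open>S_pairs\<close>.
  For \<open>k' \<le> k\<close> and \<open>l \<le> l'\<close>, an ideal containing \<open>a k\<close> but not \<open>b l\<close> is incomparable to every ideal
  containing \<open>b l'\<close> but not \<open>a k'\<close>. So the product of the corresponding partial sums of \<open>theta (a k)\<close> and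
  \<open>theta (b l')\<close> lies in the initial ideal of the toric ideal, hence so does, modulo the thetas, the
  product of the complementary partial sums, whose initial monomial belongs to the pairs \<open>(k, l)\<close> and
  \<open>(k', l')\<close>. What survives are products over strictly increasing pairs, so every standard monomial is
  in the asserted set.

  Equality follows by counting. A choice of one maximal chain in each lattice of ideals supports a
  zero of \<open>J\<close> whose coordinates on the nonempty members of the chains are nonzero, because the \<open>\<eta> c\<close>
  are distinct and nonzero; hence distinct choices give distinct zeros. There are at least as
  many standard monomials as zeros, and each element of the asserted set yields its own choice of
  chains, as lattice paths are determined by their corners.
\<close>

section \<open>Evaluation of polynomials\<close>

text \<open>Exhibiting elements of \<open>J\<close> bounds the standard monomials from above only.
  The bound from below comes from linear algebra: evaluation maps the polynomial ring onto all
  functions on a finite set of zeros, and modulo functions vanishing there every polynomial reduces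
  to standard monomials. The two bounds use the two halves of the description of the toric initial
  ideal. The upper one needs that x_\<alpha> x_\<beta> lies in it for incomparable \<alpha>, \<beta>
  of one poset; the construction of zeros needs that every initial monomial is divisible by such a
  product. Pairs with (k, l) = (k', l') are included in the product argument. They yield squares of
  variables, so squarefreeness is covered by it. On a maximal chain the equations theta c = 0 are
  triangular, and their solution consists of differences of the \<eta> of successive elements; this
  is where distinctness enters. The coordinate at the empty ideal, common to all posets, is reserved
  for theta0, so zeros are told apart at nonempty ideals.\<close>

definition mon_eval :: "('v \<Rightarrow> 'r::comm_semiring_1) \<Rightarrow> ('v \<Rightarrow>\<^sub>0 nat) \<Rightarrow> 'r" where
  "mon_eval g m = (\<Prod>v\<in>Poly_Mapping.keys m. g v ^ Poly_Mapping.lookup m v)"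

lemma mon_eval_superset:
  assumes "finite S" "Poly_Mapping.keys m \<subseteq> S"
  shows "mon_eval g m = (\<Prod>v\<in>S. g v ^ Poly_Mapping.lookup m v)"
  unfolding mon_eval_def
  by (rule prod.mono_neutral_left) (use assms in \<open>auto simp: in_keys_iff\<close>)

lemma mon_eval_add: "mon_eval g (m + n) = mon_eval g m * mon_eval g n"
proof -
  let ?S = "Poly_Mapping.keys m \<union> Poly_Mapping.keys n"
  have "mon_eval g (m + n) = (\<Prod>v\<in>?S. g v ^ Poly_Mapping.lookup (m + n) v)"
    by (rule mon_eval_superset) (use keys_add[of m n] in auto)
  also have "\<dots> = (\<Prod>v\<in>?S. g v ^ Poly_Mapping.lookup m v) * (\<Prod>v\<in>?S. g v ^ Poly_Mapping.lookup n v)"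
    by (simp add: lookup_add power_add prod.distrib)
  also have "\<dots> = mon_eval g m * mon_eval g n"
    by (simp add: mon_eval_superset[of ?S])
  finally show ?thesis .
qed

lemma mon_eval_zero [simp]: "mon_eval g 0 = 1"
  by (simp add: mon_eval_def)

lemma mon_eval_single [simp]: "mon_eval g (Poly_Mapping.single v k) = g v ^ k"
  by (cases "k = 0") (simp_all add: mon_eval_def)

lemma mon_eval_eq_0:
  fixes g :: "'v \<Rightarrow> 'r::field"
  assumes "v \<in> Poly_Mapping.keys m" "g v = 0"
  shows "mon_eval g m = 0"
  using assms by (auto simp: mon_eval_def in_keys_iff)

text \<open>Cancellation can make the support of a sum smaller than the union of the supports;
  padding with zero coefficients avoids tracking this.\<close>

lemma eval_mpoly_superset:
  assumes "finite S" "Poly_Mapping.keys f \<subseteq> S" "\<phi> 0 = 0"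
  shows "eval_mpoly \<phi> g f = (\<Sum>m\<in>S. \<phi> (Poly_Mapping.lookup f m) * mon_eval g m)"
  unfolding eval_mpoly_def mon_eval_def
  by (rule sum.mono_neutral_left) (use assms in \<open>auto simp: in_keys_iff\<close>)

lemma eval_mpoly_zero [simp]: "eval_mpoly \<phi> g 0 = 0"
  by (simp add: eval_mpoly_def)

lemma eval_mpoly_single: "\<phi> 0 = 0 \<Longrightarrow> eval_mpoly \<phi> g (Poly_Mapping.single m c) = \<phi> c * mon_eval g m"
  by (subst eval_mpoly_superset[of "{m}"]) auto

lemma eval_mpoly_Const: "\<phi> 0 = 0 \<Longrightarrow> eval_mpoly \<phi> g (Const c) = \<phi> c"
  by (simp add: Const_def eval_mpoly_single)

lemma eval_mpoly_Var: "\<phi> 0 = 0 \<Longrightarrow> \<phi> 1 = 1 \<Longrightarrow> eval_mpoly \<phi> g (Var v) = g v"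
  by (simp add: Var_def eval_mpoly_single)

lemma eval_mpoly_add:
  assumes "\<phi> 0 = 0" "\<And>x y. \<phi> (x + y) = \<phi> x + \<phi> y"
  shows "eval_mpoly \<phi> g (f + h) = eval_mpoly \<phi> g f + eval_mpoly \<phi> g h"
proof -
  let ?S = "Poly_Mapping.keys f \<union> Poly_Mapping.keys h"
  have "eval_mpoly \<phi> g (f + h) = (\<Sum>m\<in>?S. \<phi> (Poly_Mapping.lookup (f + h) m) * mon_eval g m)"
    by (rule eval_mpoly_superset) (use keys_add[of f h] assms in auto)
  then show ?thesis
    by (simp add: eval_mpoly_superset[of ?S] assms lookup_add distrib_right sum.distrib)
qed

lemma eval_mpoly_sum:
  assumes "\<phi> 0 = 0" "\<And>x y. \<phi> (x + y) = \<phi> x + \<phi> y"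
  shows "eval_mpoly \<phi> g (\<Sum>x\<in>A. f x) = (\<Sum>x\<in>A. eval_mpoly \<phi> g (f x))"
  by (induction A rule: infinite_finite_induct) (simp_all add: eval_mpoly_add assms)

lemma mpoly_mult_sum:
  "f * h = (\<Sum>m\<in>Poly_Mapping.keys f. \<Sum>n\<in>Poly_Mapping.keys h.
      Poly_Mapping.single (m + n) (Poly_Mapping.lookup f m * Poly_Mapping.lookup h n))"
  by (subst lookup_mpoly_sum[of f], subst lookup_mpoly_sum[of h])
    (simp add: sum_product mult_single)

lemma eval_mpoly_mult:
  assumes "\<phi> 0 = 0" "\<And>x y. \<phi> (x + y) = \<phi> x + \<phi> y" "\<And>x y. \<phi> (x * y) = \<phi> x * \<phi> y"
  shows "eval_mpoly \<phi> g (f * h) = eval_mpoly \<phi> g f * eval_mpoly \<phi> g h"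
proof -
  have "eval_mpoly \<phi> g (f * h) = (\<Sum>m\<in>Poly_Mapping.keys f. \<Sum>n\<in>Poly_Mapping.keys h.
      \<phi> (Poly_Mapping.lookup f m) * mon_eval g m * (\<phi> (Poly_Mapping.lookup h n) * mon_eval g n))"
    by (subst mpoly_mult_sum) (simp add: eval_mpoly_sum eval_mpoly_single assms mon_eval_add ac_simps)
  then show ?thesis
    by (simp add: sum_product eval_mpoly_def mon_eval_def)
qed

lemma eval_mpoly_prod:
  fixes \<phi> :: "'k::comm_semiring_1 \<Rightarrow> 'r::comm_semiring_1"
  assumes "\<phi> 0 = 0" "\<phi> 1 = 1" "\<And>x y. \<phi> (x + y) = \<phi> x + \<phi> y" "\<And>x y. \<phi> (x * y) = \<phi> x * \<phi> y"
  shows "eval_mpoly \<phi> g (\<Prod>x\<in>A. f x) = (\<Prod>x\<in>A. eval_mpoly \<phi> g (f x))"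
proof -
  have "eval_mpoly \<phi> g 1 = 1"
    using eval_mpoly_Const[of \<phi> g 1] assms by (simp add: Const_def)
  then show ?thesis
    by (induction A rule: infinite_finite_induct) (simp_all add: eval_mpoly_mult assms)
qed

lemma eval_mpoly_diff:
  fixes \<phi> :: "'k::comm_ring_1 \<Rightarrow> 'r::comm_ring_1"
  assumes "\<phi> 0 = 0" "\<And>x y. \<phi> (x + y) = \<phi> x + \<phi> y"
  shows "eval_mpoly \<phi> g (f - h) = eval_mpoly \<phi> g f - eval_mpoly \<phi> g h"
  using eval_mpoly_add[of \<phi> g "f - h" h] assms by (simp add: algebra_simps)

section \<open>Polynomial subrings and ideals\<close>

lemma poly_ring_zero [simp]: "0 \<in> poly_ring X"
  by (simp add: poly_ring_def)

lemma poly_ring_single: "Poly_Mapping.keys m \<subseteq> X \<Longrightarrow> Poly_Mapping.single m c \<in> poly_ring X"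
  by (auto simp: poly_ring_def)

lemma poly_ring_one [simp]: "(1::('v, 'k::zero_neq_one) mpoly) \<in> poly_ring X"
  by (auto simp: poly_ring_def)

lemma poly_ring_Const [simp]: "Const c \<in> poly_ring X"
  by (simp add: Const_def poly_ring_single)

lemma poly_ring_Var: "v \<in> X \<Longrightarrow> Var v \<in> poly_ring X"
  by (simp add: Var_def poly_ring_single)

lemma poly_ring_add: "f \<in> poly_ring X \<Longrightarrow> g \<in> poly_ring X \<Longrightarrow> f + g \<in> poly_ring X"
  using keys_add[of f g] by (fastforce simp: poly_ring_def)

lemma poly_ring_uminus: "f \<in> poly_ring X \<Longrightarrow> - (f::('v, 'k::ab_group_add) mpoly) \<in> poly_ring X"
  by (simp add: poly_ring_def)

lemma poly_ring_diff:
  "f \<in> poly_ring X \<Longrightarrow> g \<in> poly_ring X \<Longrightarrow> f - (g::('v, 'k::ab_group_add) mpoly) \<in> poly_ring X"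
  using poly_ring_add[of f X "- g"] poly_ring_uminus[of g X] by simp

lemma poly_ring_mult: "f \<in> poly_ring X \<Longrightarrow> g \<in> poly_ring X \<Longrightarrow> f * g \<in> poly_ring X"
proof -
  assume *: "f \<in> poly_ring X" "g \<in> poly_ring X"
  have "Poly_Mapping.keys m \<subseteq> X" if m: "m \<in> Poly_Mapping.keys (f * g)" for m
  proof -
    obtain k l where "m = k + l" "k \<in> Poly_Mapping.keys f" "l \<in> Poly_Mapping.keys g"
      using m keys_mult[of f g] by blast
    then show ?thesis
      using * keys_add[of k l] by (fastforce simp: poly_ring_def)
  qed
  then show ?thesis by (simp add: poly_ring_def)
qed

lemma poly_ring_sum: "(\<And>x. x \<in> A \<Longrightarrow> f x \<in> poly_ring X) \<Longrightarrow> (\<Sum>x\<in>A. f x) \<in> poly_ring X"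
  by (induction A rule: infinite_finite_induct) (auto intro: poly_ring_add)

lemma poly_ring_prod:
  "(\<And>x. x \<in> A \<Longrightarrow> f x \<in> poly_ring X) \<Longrightarrow> (\<Prod>x\<in>A. f x :: ('v, 'k::field) mpoly) \<in> poly_ring X"
  by (induction A rule: infinite_finite_induct) (auto intro: poly_ring_mult)

lemma ideal_gen_memI:
  assumes "g \<in> G" "1 \<in> R"
  shows "g \<in> ideal_gen R G"
  unfolding ideal_gen_def using assms
  by (auto intro!: exI[of _ "{g}"] exI[of _ "\<lambda>_. 1"])

lemma ideal_gen_add:
  assumes R: "0 \<in> R" "\<And>x y. x \<in> R \<Longrightarrow> y \<in> R \<Longrightarrow> x + y \<in> R"
    and "x \<in> ideal_gen R G" "y \<in> ideal_gen R G"
  shows "x + y \<in> ideal_gen R G"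
proof -
  obtain F h F' h' where F: "finite F" "F \<subseteq> G" "\<forall>g\<in>F. h g \<in> R" "x = (\<Sum>g\<in>F. h g * g)"
    and F': "finite F'" "F' \<subseteq> G" "\<forall>g\<in>F'. h' g \<in> R" "y = (\<Sum>g\<in>F'. h' g * g)"
    using assms unfolding ideal_gen_def by blast
  \<comment> \<open>The two representations may use different generators; both coefficient functions
    are extended by 0 to the union.\<close>
  define k where "k g = (if g \<in> F then h g else 0) + (if g \<in> F' then h' g else 0)" for g
  have "x = (\<Sum>g\<in>F \<union> F'. (if g \<in> F then h g else 0) * g)"
    unfolding F(4) by (rule sum.mono_neutral_cong_left) (use F F' in auto)
  moreover have "y = (\<Sum>g\<in>F \<union> F'. (if g \<in> F' then h' g else 0) * g)"
    unfolding F'(4) by (rule sum.mono_neutral_cong_left) (use F F' in auto)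
  ultimately have "x + y = (\<Sum>g\<in>F \<union> F'. k g * g)"
    by (simp add: k_def distrib_right sum.distrib)
  moreover have "\<forall>g\<in>F \<union> F'. k g \<in> R"
    using F F' R unfolding k_def by simp
  ultimately show ?thesis
    unfolding ideal_gen_def using F F' by blast
qed

lemma ideal_gen_mult:
  assumes "\<And>x y. x \<in> R \<Longrightarrow> y \<in> R \<Longrightarrow> x * y \<in> R" "c \<in> R" "x \<in> ideal_gen R G"
  shows "c * x \<in> ideal_gen R G"
proof -
  obtain F h where F: "finite F" "F \<subseteq> G" "\<forall>g\<in>F. h g \<in> R" "x = (\<Sum>g\<in>F. h g * g)"
    using assms unfolding ideal_gen_def by blast
  then have "c * x = (\<Sum>g\<in>F. (c * h g) * g)" "\<forall>g\<in>F. c * h g \<in> R"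
    using assms by (simp_all add: sum_distrib_left mult.assoc)
  then show ?thesis
    unfolding ideal_gen_def using F(1,2)
    by (intro CollectI exI[of _ F] exI[of _ "\<lambda>g. c * h g"]) simp
qed

lemma poly_ideal_add:
  "x \<in> ideal_gen (poly_ring X) G \<Longrightarrow> y \<in> ideal_gen (poly_ring X) G \<Longrightarrow> x + y \<in> ideal_gen (poly_ring X) G"
  by (rule ideal_gen_add) (auto intro: poly_ring_add)

lemma poly_ideal_mult:
  "c \<in> poly_ring X \<Longrightarrow> x \<in> ideal_gen (poly_ring X) G \<Longrightarrow> c * x \<in> ideal_gen (poly_ring X) G"
  by (rule ideal_gen_mult) (auto intro: poly_ring_mult)

lemma poly_ideal_zero: "0 \<in> ideal_gen (poly_ring X) G"
  unfolding ideal_gen_def by (auto intro!: exI[of _ "{}"])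

lemma poly_ideal_sum:
  "(\<And>x. x \<in> A \<Longrightarrow> f x \<in> ideal_gen (poly_ring X) G) \<Longrightarrow> (\<Sum>x\<in>A. f x) \<in> ideal_gen (poly_ring X) G"
  by (induction A rule: infinite_finite_induct) (auto intro: poly_ideal_add poly_ideal_zero)

lemma poly_ideal_gen: "g \<in> G \<Longrightarrow> (g::('v, 'k::field) mpoly) \<in> ideal_gen (poly_ring X) G"
  by (rule ideal_gen_memI) auto

lemma poly_ideal_subset:
  assumes "G \<subseteq> poly_ring X"
  shows "ideal_gen (poly_ring X) G \<subseteq> poly_ring X"
proof
  fix f assume "f \<in> ideal_gen (poly_ring X) G"
  then obtain F h where "F \<subseteq> G" "\<forall>g\<in>F. h g \<in> poly_ring X" "f = (\<Sum>g\<in>F. h g * g)"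
    unfolding ideal_gen_def by blast
  then show "f \<in> poly_ring X" using assms by (auto intro!: poly_ring_sum poly_ring_mult)
qed

lemma eval_mpoly_ideal_gen:
  assumes "f \<in> ideal_gen R G" "\<And>g. g \<in> G \<Longrightarrow> eval_mpoly (\<lambda>x. x) z g = 0"
  shows "eval_mpoly (\<lambda>x. x) z f = 0"
  using assms unfolding ideal_gen_def
  by (force simp: eval_mpoly_sum eval_mpoly_mult intro!: sum.neutral)

section \<open>The reverse lexicographic order\<close>

lemma deg_mon_superset:
  assumes "finite S" "Poly_Mapping.keys m \<subseteq> S"
  shows "deg_mon m = (\<Sum>v\<in>S. Poly_Mapping.lookup m v)"
  unfolding deg_mon_def
  by (rule sum.mono_neutral_left) (use assms in \<open>auto simp: in_keys_iff\<close>)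

lemma deg_mon_add: "deg_mon (m + n) = deg_mon m + deg_mon n"
proof -
  let ?S = "Poly_Mapping.keys m \<union> Poly_Mapping.keys n"
  have "deg_mon (m + n) = (\<Sum>v\<in>?S. Poly_Mapping.lookup (m + n) v)"
    by (rule deg_mon_superset) (use keys_add[of m n] in auto)
  then show ?thesis
    by (simp add: deg_mon_superset[of ?S] lookup_add sum.distrib)
qed

lemma deg_mon_zero [simp]: "deg_mon 0 = 0"
  by (simp add: deg_mon_def)

lemma deg_mon_single [simp]: "deg_mon (Poly_Mapping.single v k) = k"
  by (cases "k = 0") (simp_all add: deg_mon_def)

lemma grevlex_less_irrefl [simp]: "\<not> grevlex_less lt m m"
  by (simp add: grevlex_less_def)

lemma grevlex_less_add [simp]: "grevlex_less lt (m + k) (n + k) \<longleftrightarrow> grevlex_less lt m n"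
  by (simp add: grevlex_less_def deg_mon_add lookup_add)

lemma grevlex_less_add_left [simp]: "grevlex_less lt (k + m) (k + n) \<longleftrightarrow> grevlex_less lt m n"
  by (simp add: add.commute[of k])

locale monomial_order =
  fixes X :: "'v set" and lt :: "'v rel"
  assumes fin: "finite X" and lin: "strict_linear_order_on X lt"
begin

lemma lt_trans: "(u, v) \<in> lt \<Longrightarrow> (v, w) \<in> lt \<Longrightarrow> (u, w) \<in> lt"
  using lin unfolding strict_linear_order_on_def trans_def by blast

lemma lt_irrefl: "(u, u) \<notin> lt"
  using lin unfolding strict_linear_order_on_def irrefl_def by blast

lemma lt_asym: "(u, v) \<in> lt \<Longrightarrow> (v, u) \<notin> lt"
  using lt_trans lt_irrefl by blast

lemma lt_total: "u \<in> X \<Longrightarrow> v \<in> X \<Longrightarrow> u \<noteq> v \<Longrightarrow> (u, v) \<in> lt \<or> (v, u) \<in> lt"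
  using lin unfolding strict_linear_order_on_def total_on_def by blast

text \<open>In equal degree, the deciding variable of the first comparison occurs in
  \<open>m\<close> and that of the second in \<open>n\<close>. Both thus lie in \<open>X\<close>,
  where \<open>lt\<close> is total, and the smaller of the two decides \<open>m\<close> against
  \<open>k\<close>.\<close>

lemma grevlex_trans:
  assumes "grevlex_less lt m n" "grevlex_less lt n k"
    and "Poly_Mapping.keys m \<subseteq> X" "Poly_Mapping.keys n \<subseteq> X"
  shows "grevlex_less lt m k"
proof (cases "deg_mon m = deg_mon n \<and> deg_mon n = deg_mon k")
  case False
  then show ?thesis using assms(1,2) by (auto simp: grevlex_less_def)
next
  case True
  then obtain v w
    where v: "Poly_Mapping.lookup n v < Poly_Mapping.lookup m v"
      "\<And>u. (u, v) \<in> lt \<Longrightarrow> Poly_Mapping.lookup m u = Poly_Mapping.lookup n u"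
    and w: "Poly_Mapping.lookup k w < Poly_Mapping.lookup n w"
      "\<And>u. (u, w) \<in> lt \<Longrightarrow> Poly_Mapping.lookup n u = Poly_Mapping.lookup k u"
    using assms(1,2) by (auto simp: grevlex_less_def)
  have "v \<in> Poly_Mapping.keys m" "w \<in> Poly_Mapping.keys n"
    using v(1) w(1) by (auto simp: in_keys_iff)
  then have X: "v \<in> X" "w \<in> X" using assms by auto
  consider "v = w" | "(v, w) \<in> lt" | "(w, v) \<in> lt" using lt_total X by blast
  then have "\<exists>v. Poly_Mapping.lookup k v < Poly_Mapping.lookup m v \<and>
            (\<forall>w. (w, v) \<in> lt \<longrightarrow> Poly_Mapping.lookup m w = Poly_Mapping.lookup k w)"
  proof cases
    case 1
    then show ?thesis using v w by (intro exI[of _ v]) (auto intro: less_trans)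
  next
    case 2
    then show ?thesis using v w lt_trans by (intro exI[of _ v]) metis
  next
    case 3
    then show ?thesis using v w lt_trans by (intro exI[of _ w]) metis
  qed
  with True show ?thesis by (simp add: grevlex_less_def)
qed

lemma finite_bounded_degree: "finite {m. Poly_Mapping.keys m \<subseteq> X \<and> deg_mon m \<le> d}"
proof -
  let ?M = "{m. Poly_Mapping.keys m \<subseteq> X \<and> deg_mon m \<le> d}"
  have "finite {f. \<forall>v. (v \<in> X \<longrightarrow> f v \<in> {..d}) \<and> (v \<notin> X \<longrightarrow> f v = (0::nat))}"
    by (rule finite_set_of_finite_funs[OF fin]) simp
  moreover have "Poly_Mapping.lookup ` ?M \<subseteq> {f. \<forall>v. (v \<in> X \<longrightarrow> f v \<in> {..d}) \<and> (v \<notin> X \<longrightarrow> f v = (0::nat))}"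
  proof (rule image_subsetI)
    fix m assume "m \<in> ?M"
    then have m: "Poly_Mapping.keys m \<subseteq> X" "deg_mon m \<le> d" by auto
    have "Poly_Mapping.lookup m v \<le> d" if "v \<in> X" for v
      using member_le_sum[of v X "Poly_Mapping.lookup m"] m fin that
      by (simp add: deg_mon_superset[of X])
    moreover have "Poly_Mapping.lookup m v = 0" if "v \<notin> X" for v
      using m that by (auto simp: in_keys_iff)
    ultimately show "Poly_Mapping.lookup m \<in> {f. \<forall>v. (v \<in> X \<longrightarrow> f v \<in> {..d}) \<and> (v \<notin> X \<longrightarrow> f v = (0::nat))}"
      by simp
  qed
  ultimately have "finite (Poly_Mapping.lookup ` ?M)" by (rule rev_finite_subset)
  then show ?thesis
    by (rule finite_imageD) (auto intro: inj_onI poly_mapping_eqI)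
qed

text \<open>The order is graded, so only finitely many monomials in the variables \<open>X\<close>
  lie below a given one. Their number is the induction measure.\<close>

lemma grevlex_induct [consumes 1, case_names less]:
  assumes "Poly_Mapping.keys m \<subseteq> X"
    and "\<And>m. Poly_Mapping.keys m \<subseteq> X \<Longrightarrow>
      (\<And>n. Poly_Mapping.keys n \<subseteq> X \<Longrightarrow> grevlex_less lt n m \<Longrightarrow> Q n) \<Longrightarrow> Q m"
  shows "Q m"
  using assms(1)
proof (induction "card {n. Poly_Mapping.keys n \<subseteq> X \<and> grevlex_less lt n m}" arbitrary: m rule: less_induct)
  case less
  let ?L = "\<lambda>m. {n. Poly_Mapping.keys n \<subseteq> X \<and> grevlex_less lt n m}"
  have fL: "finite (?L m)"
    by (rule finite_subset[OF _ finite_bounded_degree[of "deg_mon m"]]) (auto simp: grevlex_less_def)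
  show ?case
  proof (rule assms(2)[OF less.prems])
    fix n assume n: "Poly_Mapping.keys n \<subseteq> X" "grevlex_less lt n m"
    have "?L n \<subseteq> ?L m" "n \<in> ?L m" "n \<notin> ?L n" using n grevlex_trans by auto
    then have "?L n \<subset> ?L m" by blast
    then show "Q n" using less.hyps n psubset_card_mono[OF fL] by blast
  qed
qed

text \<open>Every product of terms other than the two leading ones is strictly below
  \<open>m + n\<close>. The coefficient at \<open>m + n\<close> is therefore a single product of
  nonzero field elements and cannot cancel.\<close>

lemma is_initial_exponent_mult:
  assumes "is_initial_exponent lt f m" "is_initial_exponent lt g n"
    and "f \<in> poly_ring X" "g \<in> poly_ring X"
  shows "is_initial_exponent lt (f * (g :: ('v, 'k::field) mpoly)) (m + n)"
proof -
  have X: "Poly_Mapping.keys k \<subseteq> X" if "k \<in> Poly_Mapping.keys f \<union> Poly_Mapping.keys g" for k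
    using assms(3,4) that by (auto simp: poly_ring_def)
  have m: "m \<in> Poly_Mapping.keys f" and n: "n \<in> Poly_Mapping.keys g"
    using assms by (auto simp: is_initial_exponent_def)
  have less: "grevlex_less lt (k + l) (m + n)"
    if kl: "k \<in> Poly_Mapping.keys f" "l \<in> Poly_Mapping.keys g" "(k, l) \<noteq> (m, n)" for k l
  proof -
    have k: "k = m \<or> grevlex_less lt k m" and l: "l = n \<or> grevlex_less lt l n"
      using kl assms by (auto simp: is_initial_exponent_def)
    consider "k = m" "l \<noteq> n" | "k \<noteq> m" "l = n" | "k \<noteq> m" "l \<noteq> n" using kl by blast
    then show ?thesis
    proof cases
      case 3
      have "grevlex_less lt (k + l) (m + l)" "grevlex_less lt (m + l) (m + n)"
        using 3 k l by auto
      moreover have "Poly_Mapping.keys (k + l) \<subseteq> X" "Poly_Mapping.keys (m + l) \<subseteq> X"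
        using X[of k] X[of l] X[of m] kl m keys_add[of k l] keys_add[of m l] by auto
      ultimately show ?thesis by (rule grevlex_trans)
    qed (use k l in auto)
  qed
  have "Poly_Mapping.lookup (f * g) (m + n) = (\<Sum>k\<in>Poly_Mapping.keys f. \<Sum>l\<in>Poly_Mapping.keys g.
      Poly_Mapping.lookup (Poly_Mapping.single (k + l) (Poly_Mapping.lookup f k * Poly_Mapping.lookup g l)) (m + n))"
    by (subst mpoly_mult_sum) (simp add: lookup_sum)
  also have "\<dots> = (\<Sum>k\<in>Poly_Mapping.keys f. \<Sum>l\<in>Poly_Mapping.keys g.
      if k = m then if l = n then Poly_Mapping.lookup f k * Poly_Mapping.lookup g l else 0 else 0)"
  proof (intro sum.cong refl)
    fix k l assume kl: "k \<in> Poly_Mapping.keys f" "l \<in> Poly_Mapping.keys g"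
    have "k + l = m + n \<longleftrightarrow> k = m \<and> l = n"
      using less[OF kl] by (metis grevlex_less_irrefl prod.inject)
    then show "Poly_Mapping.lookup (Poly_Mapping.single (k + l) (Poly_Mapping.lookup f k * Poly_Mapping.lookup g l)) (m + n) =
      (if k = m then if l = n then Poly_Mapping.lookup f k * Poly_Mapping.lookup g l else 0 else 0)"
      by (simp add: lookup_single when_def)
  qed
  also have "\<dots> = (\<Sum>k\<in>Poly_Mapping.keys f. if k = m then Poly_Mapping.lookup f k * Poly_Mapping.lookup g n else 0)"
    using n by (intro sum.cong) (auto simp: sum.delta)
  also have "\<dots> = Poly_Mapping.lookup f m * Poly_Mapping.lookup g n"
    using m by (simp add: sum.delta)
  finally have "m + n \<in> Poly_Mapping.keys (f * g)"
    using m n by (simp add: in_keys_iff)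
  moreover have "grevlex_less lt k (m + n)" if "k \<in> Poly_Mapping.keys (f * g)" "k \<noteq> m + n" for k
    using that keys_mult[of f g] less by blast
  ultimately show ?thesis by (simp add: is_initial_exponent_def)
qed

lemma is_initial_exponent_single: "c \<noteq> 0 \<Longrightarrow> is_initial_exponent lt (Poly_Mapping.single m c) m"
  by (simp add: is_initial_exponent_def)

lemma initial_idealI:
  assumes "f \<in> I" "is_initial_exponent lt f n" "Poly_Mapping.keys k \<subseteq> X"
  shows "Poly_Mapping.single (k + n) (1::'k::field) \<in> initial_ideal X lt I"
proof -
  have "Poly_Mapping.single k (1::'k) * Poly_Mapping.single n 1 \<in> initial_ideal X lt I"
    unfolding initial_ideal_def
    by (rule poly_ideal_mult) (use assms in \<open>auto intro!: poly_ring_single poly_ideal_gen\<close>)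
  then show ?thesis by (simp add: mult_single)
qed

text \<open>The generators are monomials, and cancellation between summands only removes terms, so
  each surviving term is a multiple of a single initial monomial.\<close>

lemma keys_initial_ideal:
  assumes "g \<in> initial_ideal X lt I" "m \<in> Poly_Mapping.keys (g :: ('v, 'k::field) mpoly)"
  obtains f n k where "f \<in> I" "is_initial_exponent lt f n" "m = k + n" "Poly_Mapping.keys k \<subseteq> X"
proof -
  obtain F h where F: "finite F" "F \<subseteq> {Poly_Mapping.single m 1 |m. \<exists>f\<in>I. is_initial_exponent lt f m}"
    "\<forall>g\<in>F. h g \<in> poly_ring X" "g = (\<Sum>g\<in>F. h g * g)"
    using assms(1) unfolding initial_ideal_def ideal_gen_def by blast
  have "m \<in> (\<Union>g\<in>F. Poly_Mapping.keys (h g * g))"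
    using assms(2) keys_sum[of "\<lambda>g. h g * g" F] F(4) by auto
  then obtain u where u: "u \<in> F" "m \<in> Poly_Mapping.keys (h u * u)" by blast
  then obtain n f where n: "u = Poly_Mapping.single n 1" "f \<in> I" "is_initial_exponent lt f n"
    using F(2) by blast
  obtain k where k: "k \<in> Poly_Mapping.keys (h u)" "m = k + n"
    using u(2) keys_mult[of "h u" u] n(1) by auto
  moreover have "Poly_Mapping.keys k \<subseteq> X" using F(3) u(1) k(1) by (auto simp: poly_ring_def)
  ultimately show ?thesis using that n by blast
qed

end

section \<open>Standard monomials of the vanishing ideal of finitely many points\<close>

interpretation fun_vs: vector_space "\<lambda>(c::'k::field) (f::'t \<Rightarrow> 'k) t. c * f t"
  by standard (simp_all add: fun_eq_iff algebra_simps)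

context monomial_order
begin

text \<open>Elements of \<open>J\<close> vanish at the points, so reduction by initial terms
  expresses the function of any polynomial through those of standard monomials. Interpolation shows
  that these span all functions on \<open>Z\<close>; hence \<open>card Z\<close> is at most the
  number of standard exponents, and \<open>card M \<le> card Z\<close> forces equality.\<close>

lemma standard_exponents_eq:
  fixes J :: "('v, 'k::field) mpoly set" and z :: "'t \<Rightarrow> 'v \<Rightarrow> 'k"
  assumes J: "J \<subseteq> poly_ring X"
    and vanish: "\<And>f t. f \<in> J \<Longrightarrow> t \<in> Z \<Longrightarrow> eval_mpoly (\<lambda>x. x) (z t) f = 0"
    and sep: "\<And>s t. s \<in> Z \<Longrightarrow> t \<in> Z \<Longrightarrow> s \<noteq> t \<Longrightarrow> \<exists>v\<in>X. z s v \<noteq> z t v"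
    and std: "\<And>m. Poly_Mapping.keys m \<subseteq> X \<Longrightarrow> Poly_Mapping.single m 1 \<notin> initial_ideal X lt J \<Longrightarrow> m \<in> M"
    and M: "finite M" "card M \<le> card Z" and Z: "finite Z"
  shows "{m. Poly_Mapping.keys m \<subseteq> X \<and> Poly_Mapping.single m 1 \<notin> initial_ideal X lt J} = M"
    (is "?S = M")
proof -
  \<comment> \<open>Extension by 0 off \<open>Z\<close> lets functions on the whole type stand for
    functions on \<open>Z\<close>.\<close>
  define ev where "ev f t = (if t \<in> Z then eval_mpoly (\<lambda>x. x) (z t) f else 0)" for f t
  have ev_add: "ev (f + g) = (\<lambda>t. ev f t + ev g t)" for f g
    by (auto simp: ev_def eval_mpoly_add)
  have ev0: "ev 0 = 0" by (auto simp: ev_def fun_eq_iff)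
  have ev_sum: "ev (\<Sum>x\<in>A. h x) = (\<Sum>x\<in>A. ev (h x))" for A :: "('v \<Rightarrow>\<^sub>0 nat) set" and h
    by (induction A rule: infinite_finite_induct) (auto simp: ev_add ev0 fun_eq_iff)
  have ev_smult: "ev (Poly_Mapping.single m c) = (\<lambda>t. c * ev (Poly_Mapping.single m 1) t)" for m c
    by (auto simp: ev_def eval_mpoly_single)
  let ?T = "(\<lambda>m. ev (Poly_Mapping.single m 1)) ` ?S"
  have mon: "ev (Poly_Mapping.single m 1) \<in> fun_vs.span ?T" if "Poly_Mapping.keys m \<subseteq> X" for m
    using that
  proof (induction rule: grevlex_induct)
    case (less m)
    show ?case
    proof (cases "m \<in> ?S")
      case True
      then show ?thesis by (intro fun_vs.span_base) auto
    next
      case False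
      then have "Poly_Mapping.single m (1::'k) \<in> initial_ideal X lt J" using less by auto
      then obtain f n k where fnk: "f \<in> J" "is_initial_exponent lt f n" "m = k + n" "Poly_Mapping.keys k \<subseteq> X"
        by (rule keys_initial_ideal[where m = m]) auto
      \<comment> \<open>\<open>g\<close> vanishes at all points and has leading exponent
        \<open>m\<close>, so its leading term can be solved for in terms of smaller monomials, to
        which the induction hypothesis applies.\<close>
      define g where "g = Poly_Mapping.single k 1 * f"
      have g: "is_initial_exponent lt g m" "g \<in> poly_ring X"
        unfolding g_def fnk(3) using fnk J
        by (auto intro!: is_initial_exponent_mult is_initial_exponent_single poly_ring_mult poly_ring_single)
      have "ev g = (\<lambda>t. 0)"
        using vanish[OF fnk(1)] by (auto simp: g_def ev_def eval_mpoly_mult)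
      define c where "c = Poly_Mapping.lookup g m"
      have c: "c \<noteq> 0" and mg: "m \<in> Poly_Mapping.keys g"
        using g(1) by (auto simp: is_initial_exponent_def c_def in_keys_iff)
      let ?R = "\<Sum>n\<in>Poly_Mapping.keys g - {m}. ev (Poly_Mapping.single n (Poly_Mapping.lookup g n))"
      have "ev g = ev (\<Sum>n\<in>Poly_Mapping.keys g. Poly_Mapping.single n (Poly_Mapping.lookup g n))"
        by (simp flip: lookup_mpoly_sum)
      also have "\<dots> = ev (Poly_Mapping.single m c) + ?R"
        unfolding ev_sum c_def by (rule sum.remove) (use mg in auto)
      finally have eq: "ev (Poly_Mapping.single m c) + ?R = (\<lambda>t. 0)"
        using \<open>ev g = (\<lambda>t. 0)\<close> by simp
      have "?R \<in> fun_vs.span ?T"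
      proof (rule fun_vs.span_sum)
        fix n assume n: "n \<in> Poly_Mapping.keys g - {m}"
        then have "ev (Poly_Mapping.single n 1) \<in> fun_vs.span ?T"
          using g less.IH by (auto simp: is_initial_exponent_def poly_ring_def)
        then show "ev (Poly_Mapping.single n (Poly_Mapping.lookup g n)) \<in> fun_vs.span ?T"
          by (subst ev_smult) (rule fun_vs.span_scale)
      qed
      then have "(\<lambda>t. (- inverse c) * ?R t) \<in> fun_vs.span ?T" by (rule fun_vs.span_scale)
      moreover have "(\<lambda>t. (- inverse c) * ?R t) = ev (Poly_Mapping.single m 1)"
      proof
        fix t
        have "ev (Poly_Mapping.single m c) t + ?R t = 0"
          using fun_cong[OF eq, of t] by simp
        then have "c * ev (Poly_Mapping.single m 1) t = - ?R t"
          by (subst (asm) ev_smult) (simp add: add_eq_0_iff)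
        then show "(- inverse c) * ?R t = ev (Poly_Mapping.single m 1) t"
          using c by (simp add: field_simps)
      qed
      ultimately show ?thesis by simp
    qed
  qed
  have poly: "ev f \<in> fun_vs.span ?T" if f: "f \<in> poly_ring X" for f
  proof -
    have "ev f = (\<Sum>n\<in>Poly_Mapping.keys f. ev (Poly_Mapping.single n (Poly_Mapping.lookup f n)))"
      by (simp flip: ev_sum lookup_mpoly_sum)
    also have "\<dots> \<in> fun_vs.span ?T"
    proof (rule fun_vs.span_sum)
      fix n assume "n \<in> Poly_Mapping.keys f"
      then have "ev (Poly_Mapping.single n 1) \<in> fun_vs.span ?T"
        using f by (intro mon) (auto simp: poly_ring_def)
      then show "ev (Poly_Mapping.single n (Poly_Mapping.lookup f n)) \<in> fun_vs.span ?T"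
        by (subst ev_smult) (rule fun_vs.span_scale)
    qed
    finally show ?thesis .
  qed
  define \<delta> where "\<delta> s = (\<lambda>t. if t = s then 1 else (0::'k))" for s :: 't
  have \<delta>: "\<delta> s \<in> fun_vs.span ?T" if s: "s \<in> Z" for s
  proof -
    obtain v where v: "\<And>t. t \<in> Z \<Longrightarrow> s \<noteq> t \<Longrightarrow> v t \<in> X \<and> z s (v t) \<noteq> z t (v t)"
      using sep[OF s] by metis
    \<comment> \<open>Lagrange interpolation: the factor for \<open>t\<close> uses a variable
      \<open>v t\<close> separating \<open>s\<close> from \<open>t\<close>; it is 1 at
      \<open>s\<close> and 0 at \<open>t\<close>.\<close>
    let ?f = "\<Prod>t\<in>Z - {s}. Const (inverse (z s (v t) - z t (v t))) * (Var (v t) - Const (z t (v t)))"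
    have "?f \<in> poly_ring X"
      using v by (intro poly_ring_prod poly_ring_mult poly_ring_diff poly_ring_Const poly_ring_Var) auto
    moreover have "ev ?f = \<delta> s"
    proof
      fix u
      have ev_f: "ev ?f u = (\<Prod>t\<in>Z - {s}. inverse (z s (v t) - z t (v t)) * (z u (v t) - z t (v t)))" if "u \<in> Z"
        using that by (simp add: ev_def eval_mpoly_prod eval_mpoly_mult eval_mpoly_diff eval_mpoly_Const eval_mpoly_Var)
      show "ev ?f u = \<delta> s u"
      proof (cases "u \<in> Z")
        case True
        show ?thesis
        proof (cases "u = s")
          case True
          have "(\<Prod>t\<in>Z - {s}. inverse (z s (v t) - z t (v t)) * (z s (v t) - z t (v t))) = 1"
            by (rule prod.neutral) (use v in \<open>auto intro!: left_inverse\<close>)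
          then show ?thesis using ev_f \<open>u \<in> Z\<close> True by (simp add: \<delta>_def)
        next
          case False
          then show ?thesis using ev_f \<open>u \<in> Z\<close> Z by (auto simp: \<delta>_def prod_zero_iff)
        qed
      qed (use s in \<open>auto simp: ev_def \<delta>_def\<close>)
    qed
    ultimately show ?thesis using poly[of ?f] by simp
  qed
  have \<delta>_apply: "\<delta> t s = (if s = t then 1 else 0)" for s t
    by (simp add: \<delta>_def)
  have \<delta>_eq: "\<delta> s = \<delta> t \<longleftrightarrow> s = t" for s t
    by (metis \<delta>_def zero_neq_one)
  have sum_apply: "(\<Sum>x\<in>A. h x) s = (\<Sum>x\<in>A. h x s)" for A :: "('t \<Rightarrow> 'k) set" and h :: "_ \<Rightarrow> 't \<Rightarrow> 'k" and s
    by (induction A rule: infinite_finite_induct) simp_all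
  have "fun_vs.independent (\<delta> ` Z)"
  proof (rule fun_vs.independent_if_scalars_zero)
    show "finite (\<delta> ` Z)" using Z by simp
    fix f x assume 0: "(\<Sum>x\<in>\<delta> ` Z. (\<lambda>t. f x * x t)) = 0" and "x \<in> \<delta> ` Z"
    then obtain s where s: "x = \<delta> s" "s \<in> Z" by blast
    have "0 = (\<Sum>x\<in>\<delta> ` Z. (\<lambda>t. f x * x t)) s" using 0 by simp
    also have "\<dots> = (\<Sum>x\<in>\<delta> ` Z. f x * x s)"
      by (rule sum_apply)
    also have "\<dots> = (\<Sum>x\<in>\<delta> ` Z. if x = \<delta> s then f x else 0)"
    proof (intro sum.cong refl)
      fix y assume "y \<in> \<delta> ` Z"
      then obtain t where "y = \<delta> t" by blast
      then show "f y * y s = (if y = \<delta> s then f y else 0)"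
        by (cases "s = t") (simp_all add: \<delta>_eq \<delta>_apply)
    qed
    also have "\<dots> = f x" using s Z by (simp add: sum.delta)
    finally show "f x = 0" by simp
  qed
  moreover have "?S \<subseteq> M" using std by auto
  moreover have finT: "finite ?T" using \<open>?S \<subseteq> M\<close> M finite_subset by blast
  ultimately have "card (\<delta> ` Z) \<le> card ?T"
    using fun_vs.independent_span_bound[of ?T "\<delta> ` Z"] \<delta> by blast
  moreover have "inj_on \<delta> Z"
    by (rule inj_onI) (simp add: \<delta>_eq)
  moreover have "card ?T \<le> card ?S"
    using \<open>?S \<subseteq> M\<close> M finite_subset card_image_le by blast
  ultimately have "card M \<le> card ?S" using M by (simp add: card_image)
  then show ?thesis using \<open>?S \<subseteq> M\<close> M by (simp add: card_seteq)
qed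

end

section \<open>Linear extensions and weights\<close>

text \<open>When \<open>ws\<close> is a linear extension of a poset, these sets form a maximal chain
  of poset ideals, from the empty one to the whole poset.\<close>

definition prefix_sets :: "'a list \<Rightarrow> 'a set set" where
  "prefix_sets ws = (\<lambda>j. set (take j ws)) ` {..length ws}"

lemma prefix_sets_Nil [simp]: "prefix_sets [] = {{}}"
  by (simp add: prefix_sets_def)

lemma prefix_sets_snoc: "prefix_sets (ws @ [c]) = insert (insert c (set ws)) (prefix_sets ws)"
proof -
  have "{..length (ws @ [c])} = insert (Suc (length ws)) {..length ws}" by auto
  then have "prefix_sets (ws @ [c]) = insert (insert c (set ws)) ((\<lambda>j. set (take j (ws @ [c]))) ` {..length ws})"
    by (simp add: prefix_sets_def)
  also have "(\<lambda>j. set (take j (ws @ [c]))) ` {..length ws} = prefix_sets ws"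
    unfolding prefix_sets_def by (rule image_cong) auto
  finally show ?thesis .
qed

lemma prefix_sets_subset: "\<alpha> \<in> prefix_sets ws \<Longrightarrow> \<alpha> \<subseteq> set ws"
  by (auto simp: prefix_sets_def dest: in_set_takeD)

lemma set_in_prefix_sets: "set ws \<in> prefix_sets ws"
  by (auto simp: prefix_sets_def image_iff intro!: bexI[of _ "length ws"])

lemma prefix_sets_chain: "\<alpha> \<in> prefix_sets ws \<Longrightarrow> \<beta> \<in> prefix_sets ws \<Longrightarrow> \<alpha> \<subseteq> \<beta> \<or> \<beta> \<subseteq> \<alpha>"
proof -
  assume "\<alpha> \<in> prefix_sets ws" "\<beta> \<in> prefix_sets ws"
  then obtain i j where "\<alpha> = set (take i ws)" "\<beta> = set (take j ws)"
    by (auto simp: prefix_sets_def)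
  then show ?thesis
    using set_take_subset_set_take[of i j ws] set_take_subset_set_take[of j i ws] nat_le_linear[of i j] by blast
qed

text \<open>For \<open>ws\<close> = c_1, ..., c_N the system is triangular: the prefix of length j
  with 0 < j < N gets \<eta> c_j - \<eta> c_(j+1), the full one gets \<eta> c_N. These are nonzero
  because \<eta> is injective and nonzero on the list. Since the weights vanish off the chain, any
  finite \<open>B\<close> containing it gives the same sums.\<close>

lemma prefix_weights:
  fixes \<eta> :: "'a \<Rightarrow> 'k::field"
  assumes "distinct ws" "inj_on \<eta> (set ws)" "\<And>c. c \<in> set ws \<Longrightarrow> \<eta> c \<noteq> 0"
  shows "\<exists>Y. (ws \<noteq> [] \<longrightarrow> Y (set ws) = \<eta> (last ws)) \<and> (\<forall>\<alpha>. Y \<alpha> \<noteq> 0 \<longleftrightarrow> \<alpha> \<in> prefix_sets ws - {{}}) \<and>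
    (\<forall>B. finite B \<longrightarrow> prefix_sets ws \<subseteq> B \<longrightarrow> (\<forall>c\<in>set ws. (\<Sum>\<alpha>\<in>{\<alpha>\<in>B. c \<in> \<alpha>}. Y \<alpha>) = \<eta> c))"
  using assms
proof (induction ws rule: rev_induct)
  case Nil
  show ?case by (auto intro!: exI[of _ "\<lambda>_. 0"])
next
  case (snoc c ws)
  have "distinct ws" "inj_on \<eta> (set ws)" "\<And>c. c \<in> set ws \<Longrightarrow> \<eta> c \<noteq> 0"
    using snoc.prems by auto
  from snoc.IH[OF this] obtain Y where Y:
    "(ws \<noteq> [] \<longrightarrow> Y (set ws) = \<eta> (last ws)) \<and> (\<forall>\<alpha>. Y \<alpha> \<noteq> 0 \<longleftrightarrow> \<alpha> \<in> prefix_sets ws - {{}}) \<and>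
    (\<forall>B. finite B \<longrightarrow> prefix_sets ws \<subseteq> B \<longrightarrow> (\<forall>c\<in>set ws. (\<Sum>\<alpha>\<in>{\<alpha>\<in>B. c \<in> \<alpha>}. Y \<alpha>) = \<eta> c))" ..
  then have last: "ws \<noteq> [] \<Longrightarrow> Y (set ws) = \<eta> (last ws)"
    and supp: "\<And>\<alpha>. Y \<alpha> \<noteq> 0 \<longleftrightarrow> \<alpha> \<in> prefix_sets ws - {{}}"
    and sum: "\<And>B c. finite B \<Longrightarrow> prefix_sets ws \<subseteq> B \<Longrightarrow> c \<in> set ws \<Longrightarrow> (\<Sum>\<alpha>\<in>{\<alpha>\<in>B. c \<in> \<alpha>}. Y \<alpha>) = \<eta> c"
    by blast+
  let ?N = "insert c (set ws)"
  have c: "c \<notin> set ws" using snoc.prems by auto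
  have N: "?N \<noteq> set ws" "?N \<notin> prefix_sets ws" using c prefix_sets_subset[of ?N ws] by auto
  have YN: "Y ?N = 0" using supp N by auto
  \<comment> \<open>The new top takes weight \<open>\<eta> c\<close>, and the old top gives up the
    same amount, which keeps the sums of the earlier elements. If the old top is the empty set,
    there are no earlier elements and its weight stays 0.\<close>
  define Y' where "Y' \<alpha> = Y \<alpha> + (if \<alpha> = ?N then \<eta> c else 0) - (if \<alpha> = set ws then if ws = [] then 0 else \<eta> c else 0)" for \<alpha>
  have "Y' ?N = \<eta> c" using N YN by (simp add: Y'_def)
  moreover have "Y' \<alpha> \<noteq> 0 \<longleftrightarrow> \<alpha> \<in> prefix_sets (ws @ [c]) - {{}}" for \<alpha>
  proof (cases "\<alpha> = ?N \<or> \<alpha> = set ws")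
    case False
    then show ?thesis using supp by (simp add: Y'_def prefix_sets_snoc)
  next
    case True
    have "Y' (set ws) \<noteq> 0" if "ws \<noteq> []"
    proof -
      have "\<eta> (last ws) \<noteq> \<eta> c"
        using snoc.prems(2) c that by (auto simp: inj_on_def)
      then show ?thesis using N last that by (auto simp: Y'_def)
    qed
    moreover have "Y' (set ws) = 0" if "ws = []" using that supp[of "{}"] by (auto simp: Y'_def)
    ultimately show ?thesis
      using True \<open>Y' ?N = \<eta> c\<close> snoc.prems(3) set_in_prefix_sets[of ws] by (auto simp: prefix_sets_snoc)
  qed
  moreover have "(\<Sum>\<alpha>\<in>{\<alpha>\<in>B. d \<in> \<alpha>}. Y' \<alpha>) = \<eta> d"
    if B: "finite B" "prefix_sets (ws @ [c]) \<subseteq> B" and d: "d \<in> set (ws @ [c])" for B d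
  proof -
    have mem: "?N \<in> B" "set ws \<in> B" "d \<in> ?N" and sub: "prefix_sets ws \<subseteq> B"
      using B d set_in_prefix_sets[of ws] by (auto simp: prefix_sets_snoc)
    have "(\<Sum>\<alpha>\<in>{\<alpha>\<in>B. d \<in> \<alpha>}. Y' \<alpha>) =
        (\<Sum>\<alpha>\<in>{\<alpha>\<in>B. d \<in> \<alpha>}. Y \<alpha>) + \<eta> c - (if d \<in> set ws then \<eta> c else 0)"
      unfolding Y'_def sum_subtractf sum.distrib
      using B mem by (auto simp: sum.delta)
    also have "\<dots> = \<eta> d"
    proof (cases "d \<in> set ws")
      case True
      then show ?thesis using sum[OF B(1) sub] by simp
    next
      case False
      then have "d = c" using d by simp
      have "Y \<alpha> = 0" if "d \<in> \<alpha>" for \<alpha>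
        using supp[of \<alpha>] False that prefix_sets_subset[of \<alpha> ws] by auto
      then show ?thesis using False \<open>d = c\<close> by simp
    qed
    finally show ?thesis .
  qed
  ultimately show ?case by (intro exI[of _ Y']) simp
qed

section \<open>Posets covered by two chains\<close>

text \<open>The index data of a monomial in \<open>S_monomials\<close>, freed from its
  enumeration.\<close>

definition increasing_pairs :: "(nat \<times> nat) set \<Rightarrow> bool" where
  "increasing_pairs D \<longleftrightarrow> (\<forall>(k, l)\<in>D. \<forall>(k', l')\<in>D. k = k' \<and> l = l' \<or> k < k' \<and> l < l' \<or> k' < k \<and> l' < l)"

lemma increasing_pairsI:
  "(\<And>k l k' l'. (k, l) \<in> D \<Longrightarrow> (k', l') \<in> D \<Longrightarrow> k = k' \<and> l = l' \<or> k < k' \<and> l < l' \<or> k' < k \<and> l' < l)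
    \<Longrightarrow> increasing_pairs D"
  unfolding increasing_pairs_def by (simp add: Ball_def)

lemma increasing_pairs_less:
  "increasing_pairs D \<Longrightarrow> (k, l) \<in> D \<Longrightarrow> (k', l') \<in> D \<Longrightarrow> k \<le> k' \<Longrightarrow> k = k' \<and> l = l' \<or> k < k' \<and> l < l'"
  unfolding increasing_pairs_def by (fastforce split: prod.splits)

text \<open>Pairs of \<open>D\<close> with equal first coordinate coincide, so sorting the first
  coordinates enumerates \<open>D\<close>; the second coordinates then increase as well.\<close>

lemma increasing_pairs_enumeration:
  assumes D: "finite D" "increasing_pairs D"
  obtains k l :: "nat \<Rightarrow> nat" where "strict_mono_on {1..card D} k" "strict_mono_on {1..card D} l"
    "bij_betw (\<lambda>h. (k h, l h)) {1..card D} D"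
proof -
  define K where "K = sorted_list_of_set (fst ` D)"
  have inj: "inj_on fst D"
    using increasing_pairs_less[OF D(2)] by (force simp: inj_on_def)
  have K: "set K = fst ` D" "length K = card D" "sorted_wrt (<) K"
    using D inj by (simp_all add: K_def card_image)
  define k where "k h = K ! (h - 1)" for h
  have "\<forall>h\<in>{1..card D}. \<exists>y. (k h, y) \<in> D"
  proof
    fix h assume "h \<in> {1..card D}"
    then have "k h \<in> fst ` D" using K nth_mem[of "h - 1" K] by (auto simp: k_def)
    then show "\<exists>y. (k h, y) \<in> D" by force
  qed
  then obtain l where l: "\<And>h. h \<in> {1..card D} \<Longrightarrow> (k h, l h) \<in> D" by metis
  have k: "strict_mono_on {1..card D} k"
    using K(3) by (auto simp: strict_mono_on_def k_def K(2)[symmetric] sorted_wrt_iff_nth_less)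
  have l': "strict_mono_on {1..card D} l"
  proof (rule strict_mono_onI)
    fix x y assume xy: "x \<in> {1..card D}" "y \<in> {1..card D}" "x < y"
    then have "k x < k y" using k by (simp add: strict_mono_on_def)
    then show "l x < l y" using increasing_pairs_less[OF D(2) l[OF xy(1)] l[OF xy(2)]] by auto
  qed
  have "inj_on (\<lambda>h. (k h, l h)) {1..card D}"
    using k by (auto intro!: inj_onI dest: strict_mono_on_eqD)
  moreover from this have "(\<lambda>h. (k h, l h)) ` {1..card D} = D"
    using l D(1) by (intro card_subset_eq) (auto simp: card_image)
  ultimately have "bij_betw (\<lambda>h. (k h, l h)) {1..card D} D"
    by (simp add: bij_betw_def)
  then show ?thesis using that k l' by blast
qed

locale two_chain_poset =
  fixes P :: "'a set" and r :: "'a rel" and m :: nat and a :: "nat \<Rightarrow> 'a" and n :: nat and b :: "nat \<Rightarrow> 'a"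
  assumes order: "partial_order_on P r" and chains: "two_chains P r m a n b"
begin

abbreviation A where "A \<equiv> ideal_pairs P r m a n b"
abbreviation al where "al \<equiv> alpha a b"
abbreviation ls where "ls \<equiv> l_sharp A"

section \<open>Coordinates of elements and ideals along the two chains\<close>

lemma r_refl: "x \<in> P \<Longrightarrow> (x, x) \<in> r"
  and r_trans: "(x, y) \<in> r \<Longrightarrow> (y, z) \<in> r \<Longrightarrow> (x, z) \<in> r"
  and r_antisym: "(x, y) \<in> r \<Longrightarrow> (y, x) \<in> r \<Longrightarrow> x = y"
  using order unfolding partial_order_on_def preorder_on_def refl_on_def trans_def antisym_def by blast+

lemma P_eq: "P = a ` {1..m} \<union> b ` {1..n}" and disj: "a ` {1..m} \<inter> b ` {1..n} = {}"
  using chains by (auto simp: two_chains_def)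

lemma finite_P: "finite P" by (simp add: P_eq)

lemma a_less: "1 \<le> j \<Longrightarrow> j < k \<Longrightarrow> k \<le> m \<Longrightarrow> (a j, a k) \<in> r \<and> a j \<noteq> a k"
  using chains by (auto simp: two_chains_def)

lemma b_less: "1 \<le> j \<Longrightarrow> j < k \<Longrightarrow> k \<le> n \<Longrightarrow> (b j, b k) \<in> r \<and> b j \<noteq> b k"
  using chains by (auto simp: two_chains_def)

lemma a_in: "1 \<le> j \<Longrightarrow> j \<le> m \<Longrightarrow> a j \<in> P" and b_in: "1 \<le> j \<Longrightarrow> j \<le> n \<Longrightarrow> b j \<in> P"
  by (auto simp: P_eq)

lemma a_le_iff: "1 \<le> j \<Longrightarrow> j \<le> m \<Longrightarrow> 1 \<le> k \<Longrightarrow> k \<le> m \<Longrightarrow> (a j, a k) \<in> r \<longleftrightarrow> j \<le> k"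
  using a_less[of j k] a_less[of k j] r_refl[OF a_in] r_antisym by (metis linorder_not_less nat_less_le)

lemma b_le_iff: "1 \<le> j \<Longrightarrow> j \<le> n \<Longrightarrow> 1 \<le> k \<Longrightarrow> k \<le> n \<Longrightarrow> (b j, b k) \<in> r \<longleftrightarrow> j \<le> k"
  using b_less[of j k] b_less[of k j] r_refl[OF b_in] r_antisym by (metis linorder_not_less nat_less_le)

lemma a_eq_iff: "1 \<le> j \<Longrightarrow> j \<le> m \<Longrightarrow> 1 \<le> k \<Longrightarrow> k \<le> m \<Longrightarrow> a j = a k \<longleftrightarrow> j = k"
  by (metis a_less nat_neq_iff)

lemma b_eq_iff: "1 \<le> j \<Longrightarrow> j \<le> n \<Longrightarrow> 1 \<le> k \<Longrightarrow> k \<le> n \<Longrightarrow> b j = b k \<longleftrightarrow> j = k"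
  by (metis b_less nat_neq_iff)

lemma a_neq_b: "1 \<le> j \<Longrightarrow> j \<le> m \<Longrightarrow> 1 \<le> k \<Longrightarrow> k \<le> n \<Longrightarrow> a j \<noteq> b k"
  using disj by fastforce

lemma a_mem_alpha: "1 \<le> j \<Longrightarrow> j \<le> m \<Longrightarrow> k \<le> m \<Longrightarrow> l \<le> n \<Longrightarrow> a j \<in> al k l \<longleftrightarrow> j \<le> k"
  using a_eq_iff a_neq_b by (fastforce simp: alpha_def)

lemma b_mem_alpha: "1 \<le> j \<Longrightarrow> j \<le> n \<Longrightarrow> k \<le> m \<Longrightarrow> l \<le> n \<Longrightarrow> b j \<in> al k l \<longleftrightarrow> j \<le> l"
  using b_eq_iff a_neq_b by (fastforce simp: alpha_def)

lemma P_cases [consumes 1, case_names a b]: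
  assumes "x \<in> P"
  obtains j where "x = a j" "1 \<le> j" "j \<le> m" | j where "x = b j" "1 \<le> j" "j \<le> n"
  using assms by (auto simp: P_eq)

lemma alpha_subset: "k \<le> m \<Longrightarrow> l \<le> n \<Longrightarrow> al k l \<subseteq> P"
  by (auto simp: alpha_def P_eq)

lemma alpha_mono: "k \<le> k' \<Longrightarrow> l \<le> l' \<Longrightarrow> al k l \<subseteq> al k' l'"
  by (auto simp: alpha_def)

lemma alpha_subset_iff:
  assumes "k \<le> m" "l \<le> n" "k' \<le> m" "l' \<le> n"
  shows "al k l \<subseteq> al k' l' \<longleftrightarrow> k \<le> k' \<and> l \<le> l'"
proof
  assume *: "al k l \<subseteq> al k' l'"
  have "k \<le> k'"
    using a_mem_alpha[of k k l] a_mem_alpha[of k k' l'] * assms by (cases "k = 0") auto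
  moreover have "l \<le> l'"
    using b_mem_alpha[of l k l] b_mem_alpha[of l k' l'] * assms by (cases "l = 0") auto
  ultimately show "k \<le> k' \<and> l \<le> l'" ..
qed (auto intro: alpha_mono[THEN subsetD])

lemma alpha_eq_iff:
  assumes "k \<le> m" "l \<le> n" "k' \<le> m" "l' \<le> n"
  shows "al k l = al k' l' \<longleftrightarrow> k = k' \<and> l = l'"
  using alpha_subset_iff[OF assms] alpha_subset_iff[of k' l' k l] assms by auto

lemma A_bounds: "(k, l) \<in> A \<Longrightarrow> k \<le> m \<and> l \<le> n"
  and A_ideal: "(k, l) \<in> A \<Longrightarrow> al k l \<in> poset_ideals P r"
  by (auto simp: ideal_pairs_def)

lemma finite_A: "finite A"
  by (rule finite_subset[of _ "{..m} \<times> {..n}"]) (auto simp: ideal_pairs_def)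

text \<open>An ideal meets each chain in an initial segment; \<open>k\<close> and \<open>l\<close>
  are the two lengths. The inserted 0 covers an empty intersection.\<close>

lemma ideal_eq_alpha:
  assumes "\<alpha> \<in> poset_ideals P r"
  obtains k l where "(k, l) \<in> A" "\<alpha> = al k l"
proof -
  have sub: "\<alpha> \<subseteq> P" and down: "\<And>x y. x \<in> \<alpha> \<Longrightarrow> y \<in> P \<Longrightarrow> (y, x) \<in> r \<Longrightarrow> y \<in> \<alpha>"
    using assms by (auto simp: poset_ideals_def)
  define k where "k = Max (insert 0 {j. 1 \<le> j \<and> j \<le> m \<and> a j \<in> \<alpha>})"
  define l where "l = Max (insert 0 {j. 1 \<le> j \<and> j \<le> n \<and> b j \<in> \<alpha>})"
  have k: "k = 0 \<or> 1 \<le> k \<and> k \<le> m \<and> a k \<in> \<alpha>" "\<And>j. 1 \<le> j \<Longrightarrow> j \<le> m \<Longrightarrow> a j \<in> \<alpha> \<Longrightarrow> j \<le> k"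
    using Max_in[of "insert 0 {j. 1 \<le> j \<and> j \<le> m \<and> a j \<in> \<alpha>}"] by (auto simp: k_def)
  have l: "l = 0 \<or> 1 \<le> l \<and> l \<le> n \<and> b l \<in> \<alpha>" "\<And>j. 1 \<le> j \<Longrightarrow> j \<le> n \<Longrightarrow> b j \<in> \<alpha> \<Longrightarrow> j \<le> l"
    using Max_in[of "insert 0 {j. 1 \<le> j \<and> j \<le> n \<and> b j \<in> \<alpha>}"] by (auto simp: l_def)
  have "k \<le> m" "l \<le> n" using k l by auto
  have ak: "a j \<in> \<alpha> \<longleftrightarrow> j \<le> k" if "1 \<le> j" "j \<le> m" for j
    using k that down[of "a k" "a j"] a_in a_le_iff[of j k] by auto
  have bl: "b j \<in> \<alpha> \<longleftrightarrow> j \<le> l" if "1 \<le> j" "j \<le> n" for j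
    using l that down[of "b l" "b j"] b_in b_le_iff[of j l] by auto
  have "x \<in> \<alpha> \<longleftrightarrow> x \<in> al k l" if "x \<in> P" for x
    using that \<open>k \<le> m\<close> \<open>l \<le> n\<close>
    by (cases rule: P_cases) (simp_all add: ak bl a_mem_alpha b_mem_alpha)
  then have "\<alpha> = al k l" using sub alpha_subset[OF \<open>k \<le> m\<close> \<open>l \<le> n\<close>] by blast
  moreover from this have "(k, l) \<in> A"
    using assms \<open>k \<le> m\<close> \<open>l \<le> n\<close> by (simp add: ideal_pairs_def)
  ultimately show ?thesis using that by blast
qed

text \<open>Meets and joins of grid points correspond to intersections and unions of ideals. With
  \<open>A_max\<close> this makes \<open>A\<close> a sublattice of the grid, from which many later
  memberships in \<open>A\<close> are derived.\<close>

lemma A_min: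
  assumes "(k, l) \<in> A" "(k', l') \<in> A"
  shows "(min k k', min l l') \<in> A"
proof -
  have bd: "k \<le> m" "l \<le> n" "k' \<le> m" "l' \<le> n" using assms A_bounds by auto
  have "x \<in> al (min k k') (min l l') \<longleftrightarrow> x \<in> al k l \<inter> al k' l'" if "x \<in> P" for x
    using that bd by (cases rule: P_cases) (auto simp: a_mem_alpha b_mem_alpha)
  moreover have "al (min k k') (min l l') \<subseteq> P" "al k l \<subseteq> P"
    using bd by (simp_all add: alpha_subset min.coboundedI1)
  ultimately have "al (min k k') (min l l') = al k l \<inter> al k' l'" by blast
  then have "al (min k k') (min l l') \<in> poset_ideals P r"
    using A_ideal assms by (fastforce simp: poset_ideals_def)
  then show ?thesis using bd by (simp add: ideal_pairs_def min.coboundedI1)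
qed

lemma A_max:
  assumes "(k, l) \<in> A" "(k', l') \<in> A"
  shows "(max k k', max l l') \<in> A"
proof -
  have bd: "k \<le> m" "l \<le> n" "k' \<le> m" "l' \<le> n" using assms A_bounds by auto
  have "al (max k k') (max l l') = al k l \<union> al k' l'"
    by (auto simp: alpha_def max_def)
  then have "al (max k k') (max l l') \<in> poset_ideals P r"
    using A_ideal assms by (fastforce simp: poset_ideals_def)
  then show ?thesis using bd by (simp add: ideal_pairs_def)
qed

text \<open>Elements below some \<open>a j\<close> stay in the lower ideal. For elements below some
  \<open>b j\<close>, the upper ideal bounds those of the first chain by \<open>k\<close>, and the
  chain order bounds those of the second by \<open>j\<close>.\<close>

lemma A_column:
  assumes "(k, l) \<in> A" "(k, l') \<in> A" "l \<le> x" "x \<le> l'"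
  shows "(k, x) \<in> A"
proof -
  have bd: "k \<le> m" "l \<le> n" "l' \<le> n" "x \<le> n" using assms A_bounds by fastforce+
  have "z \<in> al k x" if y: "y \<in> al k x" and z: "z \<in> P" "(z, y) \<in> r" for y z
  proof -
    have "y \<in> P" using y alpha_subset bd by auto
    then show ?thesis
    proof (cases rule: P_cases)
      case (a j)
      then have "y \<in> al k l" using y bd by (simp add: a_mem_alpha)
      then have "z \<in> al k l" using A_ideal[OF assms(1)] z by (auto simp: poset_ideals_def)
      then show ?thesis using alpha_mono[of k k l x] assms by auto
    next
      case (b j)
      have "y \<in> al k l'" using y alpha_mono[of k k x l'] assms by auto
      then have z': "z \<in> al k l'" using A_ideal[OF assms(2)] z by (auto simp: poset_ideals_def)
      from z(1) show ?thesis
      proof (cases rule: P_cases)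
        case (a i)
        then show ?thesis using z' bd by (simp add: a_mem_alpha)
      next
        case b': (b i)
        have "i \<le> j" using z(2) b b' b_le_iff by simp
        then show ?thesis using b b' y bd by (simp add: b_mem_alpha)
      qed
    qed
  qed
  then show ?thesis using bd alpha_subset[of k x] by (auto simp: ideal_pairs_def poset_ideals_def)
qed

lemma A_zero: "(0, 0) \<in> A" and A_top: "(m, n) \<in> A"
proof -
  show "(0, 0) \<in> A" by (simp add: ideal_pairs_def alpha_def poset_ideals_def)
  have "al m n = P" by (simp add: alpha_def P_eq)
  then show "(m, n) \<in> A" by (simp add: ideal_pairs_def poset_ideals_def)
qed

text \<open>The generator \<open>a k\<close> is the largest element of the first chain in its
  principal ideal, so the first coordinate is \<open>k\<close> itself.\<close>

lemma principal_ideal: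
  assumes "1 \<le> k" "k \<le> m"
  obtains l where "(k, l) \<in> A" "al k l = {y \<in> P. (y, a k) \<in> r}"
proof -
  have "{y \<in> P. (y, a k) \<in> r} \<in> poset_ideals P r"
    using r_trans by (auto simp: poset_ideals_def)
  then obtain k' l where k': "(k', l) \<in> A" "{y \<in> P. (y, a k) \<in> r} = al k' l"
    by (rule ideal_eq_alpha)
  have bd: "k' \<le> m" "l \<le> n" using A_bounds k' by auto
  have "a k \<in> al k' l" using k'(2) r_refl a_in assms by blast
  then have "k \<le> k'" using a_mem_alpha assms bd by simp
  then have "a k' \<in> al k' l" using a_mem_alpha[of k' k' l] assms bd by simp
  then have "(a k', a k) \<in> r" using k'(2) by blast
  then have "k' = k" using a_le_iff[of k' k] assms bd \<open>k \<le> k'\<close> by simp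
  then show ?thesis using that k' by simp
qed

section \<open>The lower boundary of \<open>A\<close> and the pairs off both boundaries\<close>

lemma ls_least: "(k, l) \<in> A \<Longrightarrow> ls k \<le> l"
  by (simp add: l_sharp_def Least_le)

lemma ls_in: "k \<le> m \<Longrightarrow> (k, ls k) \<in> A"
proof -
  assume "k \<le> m"
  then have "\<exists>l. (k, l) \<in> A" using A_zero principal_ideal[of k] by (cases "k = 0") auto
  then show ?thesis unfolding l_sharp_def by (rule LeastI_ex)
qed

lemma ls_mono: "k \<le> k' \<Longrightarrow> k' \<le> m \<Longrightarrow> ls k \<le> ls k'"
  using A_min[OF ls_in[of k] ls_in[of k']] ls_least[of k "min (ls k) (ls k')"] by (simp add: min_def split: if_splits)

lemma ls_zero: "ls 0 = 0"
  using ls_least[OF A_zero] by simp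

text \<open>The lowest pair of column \<open>Suc k\<close> is the principal ideal of
  \<open>a (Suc k)\<close>, and deleting the generator of a principal ideal leaves an ideal. So a
  path may enter column \<open>Suc k\<close> at its lowest height.\<close>

lemma ls_prev:
  assumes "Suc k \<le> m"
  shows "(k, ls (Suc k)) \<in> A"
proof -
  obtain l where l: "(Suc k, l) \<in> A" "al (Suc k) l = {y \<in> P. (y, a (Suc k)) \<in> r}"
    using principal_ideal[of "Suc k"] assms by auto
  have in_A: "(Suc k, ls (Suc k)) \<in> A" using ls_in assms by blast
  have bd: "l \<le> n" "ls (Suc k) \<le> n" using A_bounds l in_A by blast+
  have "al (Suc k) l \<subseteq> al (Suc k) (ls (Suc k))"
    using A_ideal[OF in_A] a_mem_alpha[of "Suc k" "Suc k" "ls (Suc k)"] assms bd l(2)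
    by (auto simp: poset_ideals_def)
  then have "l \<le> ls (Suc k)" using alpha_subset_iff assms bd by blast
  then have ls: "ls (Suc k) = l" using ls_least[OF l(1)] by simp
  have eq: "al k l = al (Suc k) l - {a (Suc k)}"
  proof -
    have "al (Suc k) l = insert (a (Suc k)) (al k l)"
      by (simp add: alpha_def atLeastAtMostSuc_conv)
    then show ?thesis using assms bd a_mem_alpha[of "Suc k" k l] by auto
  qed
  have "y \<in> al (Suc k) l - {a (Suc k)}"
    if "x \<in> al (Suc k) l - {a (Suc k)}" "y \<in> P" "(y, x) \<in> r" for x y
    using that l(2) r_trans r_antisym by blast
  moreover have "al k l \<subseteq> P" using alpha_subset assms bd by simp
  ultimately have "al k l \<in> poset_ideals P r"
    unfolding poset_ideals_def eq by blast
  then show ?thesis using ls assms bd by (simp add: ideal_pairs_def)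
qed

lemma S_pairs_subset: "S_pairs P r m a n b \<subseteq> A"
  by (auto simp: S_pairs_def Let_def)

lemma S_pairsD:
  assumes "(k, l) \<in> S_pairs P r m a n b"
  shows "(k, l) \<in> A" "1 \<le> k" "k \<le> m" "1 \<le> l" "l \<le> n" "ls k < l" "(k - 1, l) \<in> A"
proof -
  show A: "(k, l) \<in> A" using assms S_pairs_subset by blast
  then show bd: "k \<le> m" "l \<le> n" using A_bounds by auto
  have "l \<noteq> ls k" and fl: "k \<noteq> k_flat A l" using assms bd by (auto simp: S_pairs_def Let_def)
  then show ls: "ls k < l" using ls_least[OF A] by simp
  then show "1 \<le> l" by simp
  have "k_flat A l \<le> k" unfolding k_flat_def by (rule Least_le) (rule A)
  then have less: "k_flat A l < k" using fl by simp
  then show "1 \<le> k" by simp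
  have flat: "(k_flat A l, l) \<in> A" unfolding k_flat_def by (rule LeastI) (rule A)
  \<comment> \<open>The join of the leftmost pair of row \<open>l\<close> with the lowest pair of
    column \<open>k - 1\<close> is \<open>(k - 1, l)\<close>, since \<open>k_flat A l < k\<close>
    and \<open>ls (k - 1) \<le> l\<close>.\<close>
  have "(max (k_flat A l) (k - 1), max l (ls (k - 1))) \<in> A"
    using bd by (intro A_max flat ls_in) auto
  moreover have "ls (k - 1) \<le> l" using ls_mono[of "k - 1" k] bd ls by simp
  ultimately show "(k - 1, l) \<in> A" using less by (simp add: max_def split: if_splits)
qed

lemma S_monomials_eq:
  "S_monomials P r m a n b =
    {\<Prod>(k, l)\<in>D. Var (al k l) |D. D \<subseteq> S_pairs P r m a n b \<and> increasing_pairs D}"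
proof (intro equalityI subsetI)
  fix u :: "('a set, 'k::comm_semiring_1) mpoly"
  assume "u \<in> S_monomials P r m a n b"
  then obtain d k l where u: "u = (\<Prod>h\<in>{1..d}. Var (al (k h) (l h)))"
    and S: "\<forall>h\<in>{1..d}. (k h, l h) \<in> S_pairs P r m a n b"
    and k: "strict_mono_on {1..d::nat} k" and l: "strict_mono_on {1..d} l"
    unfolding S_monomials_def by blast
  let ?D = "(\<lambda>h. (k h, l h)) ` {1..d}"
  have "inj_on (\<lambda>h. (k h, l h)) {1..d}"
    using k by (auto intro!: inj_onI dest: strict_mono_on_eqD)
  then have "u = (\<Prod>(k, l)\<in>?D. Var (al k l))"
    by (simp add: u prod.reindex)
  moreover have "increasing_pairs ?D"
  proof -
    have "k x = k y \<and> l x = l y \<or> k x < k y \<and> l x < l y \<or> k y < k x \<and> l y < l x"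
      if "x \<in> {1..d}" "y \<in> {1..d}" for x y
      using that k l by (metis nat_neq_iff strict_mono_onD)
    then show ?thesis unfolding increasing_pairs_def by (simp only: ball_simps case_prod_conv) blast
  qed
  ultimately show "u \<in> {\<Prod>(k, l)\<in>D. Var (al k l) |D. D \<subseteq> S_pairs P r m a n b \<and> increasing_pairs D}"
    using S by blast
next
  fix u :: "('a set, 'k::comm_semiring_1) mpoly"
  assume "u \<in> {\<Prod>(k, l)\<in>D. Var (al k l) |D. D \<subseteq> S_pairs P r m a n b \<and> increasing_pairs D}"
  then obtain D where u: "u = (\<Prod>(k, l)\<in>D. Var (al k l))"
    and D: "D \<subseteq> S_pairs P r m a n b" "increasing_pairs D" by blast
  have "finite D" using D S_pairs_subset finite_A finite_subset by metis
  then obtain k l where kl: "strict_mono_on {1..card D} k" "strict_mono_on {1..card D} l"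
    "bij_betw (\<lambda>h. (k h, l h)) {1..card D} D"
    using increasing_pairs_enumeration D by blast
  have "u = (\<Prod>h\<in>{1..card D}. Var (al (k h) (l h)))"
    unfolding u by (subst prod.reindex_bij_betw[OF kl(3), symmetric]) simp
  moreover have S: "(k h, l h) \<in> S_pairs P r m a n b" if "h \<in> {1..card D}" for h
    using D kl(3) that by (auto simp: bij_betw_def)
  ultimately show "u \<in> S_monomials P r m a n b"
    unfolding S_monomials_def using kl(1,2) S_pairsD[OF S]
    by (intro CollectI exI[of _ "card D"] exI[of _ k] exI[of _ l]) (auto simp: S Suc_le_eq)
qed

text \<open>A set \<open>D\<close> of pairs determines the lattice path through \<open>A\<close> that enters column \<open>k\<close> at
  height \<open>height D k\<close>; the elements \<open>(k, l)\<close> of \<open>D\<close> are recovered as the shifted corners,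
  where the path turns right at \<open>(k - 1, l)\<close> although \<open>(k, l - 1)\<close> lies in \<open>A\<close>.\<close>

definition height :: "(nat \<times> nat) set \<Rightarrow> nat \<Rightarrow> nat" where
  "height D k = (if k \<le> m then Max (insert (ls k) {l. \<exists>k'\<le>k. (k', l) \<in> D}) else n)"

text \<open>The path climbs column \<open>k\<close> from \<open>height D k\<close> to
  \<open>height D (Suc k)\<close> and then steps right. The value \<open>n\<close> of
  \<open>height\<close> beyond column \<open>m\<close> makes the last column end at the whole
  poset.\<close>

definition path_ideals :: "(nat \<times> nat) set \<Rightarrow> 'a set set" where
  "path_ideals D = {al k l |k l. k \<le> m \<and> height D k \<le> l \<and> l \<le> height D (Suc k)}"

context
  fixes D assumes D: "D \<subseteq> S_pairs P r m a n b" "increasing_pairs D"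
begin

lemma finite_heights: "finite {l. \<exists>k'\<le>k. (k', l) \<in> D}"
  by (rule finite_subset[of _ "{..n}"]) (use D(1) S_pairsD in auto)

lemma height_cases: "k \<le> m \<Longrightarrow> height D k = ls k \<or> (\<exists>k'\<le>k. (k', height D k) \<in> D)"
  using Max_in[of "insert (ls k) {l. \<exists>k'\<le>k. (k', l) \<in> D}"] finite_heights[of k]
  by (auto simp: height_def)

lemma height_ge_ls: "k \<le> m \<Longrightarrow> ls k \<le> height D k"
  using finite_heights[of k] by (simp add: height_def)

lemma height_ge: "k \<le> m \<Longrightarrow> k' \<le> k \<Longrightarrow> (k', l) \<in> D \<Longrightarrow> l \<le> height D k"
  using finite_heights[of k] by (auto simp: height_def intro!: Max_ge)

text \<open>A height attained by an earlier pair of \<open>D\<close> is carried to column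
  \<open>k\<close> by joining that pair with \<open>(k, ls k)\<close>.\<close>

lemma height_in: "k \<le> m \<Longrightarrow> (k, height D k) \<in> A"
proof -
  assume k: "k \<le> m"
  from height_cases[OF k] show ?thesis
  proof (elim disjE exE conjE)
    assume "height D k = ls k"
    then show ?thesis using ls_in k by simp
  next
    fix k' assume "k' \<le> k" "(k', height D k) \<in> D"
    then have "(max k' k, max (height D k) (ls k)) \<in> A"
      using D(1) S_pairs_subset k by (intro A_max ls_in) auto
    then show ?thesis using \<open>k' \<le> k\<close> height_ge_ls[OF k] by (simp add: max_def split: if_splits)
  qed
qed

lemma height_Suc_ge: "k \<le> m \<Longrightarrow> height D k \<le> height D (Suc k)"
proof (cases "Suc k \<le> m")
  case True
  then show ?thesis
    using height_cases[of k] ls_mono[of k "Suc k"] height_ge_ls[of "Suc k"] height_ge[of "Suc k"]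
    by (metis Suc_leD le_SucI le_refl le_trans)
next
  case False
  assume "k \<le> m"
  then show ?thesis using A_bounds[OF height_in] False by (simp add: height_def)
qed

lemma height_mono: "j \<le> k \<Longrightarrow> k \<le> Suc m \<Longrightarrow> height D j \<le> height D k"
proof (induction k)
  case (Suc k)
  then show ?case
    using height_Suc_ge[of k] by (cases "j = Suc k") (auto intro: le_trans)
qed simp

lemma height_le: "k \<le> Suc m \<Longrightarrow> height D k \<le> n"
  using height_mono[of k "Suc m"] by (simp add: height_def)

lemma height_zero: "height D 0 = 0"
proof -
  have "(k', l) \<notin> D" if "k' \<le> 0" for k' l using D(1) S_pairsD(2) that by fastforce
  then show ?thesis using height_cases[of 0] ls_zero by auto
qed

text \<open>This is the point from which the path steps right. If the next height lies on the lower
  boundary, \<open>ls_prev\<close> applies; if it comes from a pair of \<open>D\<close> in the next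
  column, the left neighbour of that pair is in \<open>A\<close>; if from an earlier pair, a join
  with \<open>(k, ls k)\<close> gives the point.\<close>

lemma height_Suc_in:
  assumes "k \<le> m"
  shows "(k, height D (Suc k)) \<in> A"
proof (cases "Suc k \<le> m")
  case False
  then have "k = m" "height D (Suc k) = n" using assms by (auto simp: height_def)
  then show ?thesis using A_top by simp
next
  case True
  from height_cases[OF True] show ?thesis
  proof (elim disjE exE conjE)
    assume "height D (Suc k) = ls (Suc k)"
    then show ?thesis using ls_prev True by simp
  next
    fix k' assume k': "k' \<le> Suc k" "(k', height D (Suc k)) \<in> D"
    show ?thesis
    proof (cases "k' = Suc k")
      case True
      then show ?thesis using S_pairsD(7)[of k' "height D (Suc k)"] k' D(1) by auto
    next
      case False
      have "(max k' k, max (height D (Suc k)) (ls k)) \<in> A"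
        using D(1) S_pairs_subset k' assms by (intro A_max ls_in) auto
      moreover have "ls k \<le> height D (Suc k)"
        using ls_mono[of k "Suc k"] height_ge_ls[of "Suc k"] True by simp
      ultimately show ?thesis using k' False by (simp add: max_def split: if_splits)
    qed
  qed
qed

lemma path_in: "k \<le> m \<Longrightarrow> height D k \<le> l \<Longrightarrow> l \<le> height D (Suc k) \<Longrightarrow> (k, l) \<in> A"
  using A_column[OF height_in height_Suc_in] by blast

lemma path_ideals_subset: "path_ideals D \<subseteq> poset_ideals P r"
  using path_in A_ideal by (auto simp: path_ideals_def)

lemma mem_path_ideals:
  assumes "k \<le> m" "l \<le> n"
  shows "al k l \<in> path_ideals D \<longleftrightarrow> height D k \<le> l \<and> l \<le> height D (Suc k)"
  using assms height_le alpha_eq_iff[of k l] unfolding path_ideals_def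
  by (smt (verit, ccfv_threshold) Suc_le_mono le_trans mem_Collect_eq)

text \<open>Pairs of \<open>D\<close> are the places where the height rises above both its previous
  value and the lower boundary. A height above \<open>ls k\<close> must come from some pair of
  \<open>D\<close>; if that pair lay in an earlier column, the previous height would already be as
  large. Conversely, a pair of \<open>D\<close> exceeds all earlier ones because \<open>D\<close> is
  increasing.\<close>

lemma mem_iff_height:
  "(k, l) \<in> D \<longleftrightarrow> 1 \<le> k \<and> k \<le> m \<and> l = height D k \<and> height D (k - 1) < l \<and> ls k < l"
proof
  assume kl: "(k, l) \<in> D"
  then have S: "(k, l) \<in> S_pairs P r m a n b" using D by blast
  note k = S_pairsD[OF S]
  have "l \<le> height D k" using height_ge kl k by blast
  moreover have "height D k \<le> l"
    using height_cases[OF k(3)] k(6) increasing_pairs_less[OF D(2) _ kl] by fastforce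
  moreover have "height D (k - 1) < l"
  proof -
    have "height D (k - 1) = ls (k - 1) \<or> (\<exists>k'\<le>k - 1. (k', height D (k - 1)) \<in> D)"
      using height_cases[of "k - 1"] k(3) by simp
    then show ?thesis
    proof (elim disjE exE conjE)
      assume "height D (k - 1) = ls (k - 1)"
      then show ?thesis using ls_mono[of "k - 1" k] k by simp
    next
      fix k' assume "k' \<le> k - 1" "(k', height D (k - 1)) \<in> D"
      then show ?thesis using increasing_pairs_less[OF D(2) _ kl] k(2) by fastforce
    qed
  qed
  ultimately show "1 \<le> k \<and> k \<le> m \<and> l = height D k \<and> height D (k - 1) < l \<and> ls k < l"
    using k by simp
next
  assume kl: "1 \<le> k \<and> k \<le> m \<and> l = height D k \<and> height D (k - 1) < l \<and> ls k < l"
  then obtain k' where k': "k' \<le> k" "(k', l) \<in> D" using height_cases[of k] by auto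
  have "k - 1 \<le> m" using kl by linarith
  then have "\<not> k' \<le> k - 1" using height_ge[of "k - 1" k' l] k' kl by auto
  then have "k' = k" using k' by simp
  then show "(k, l) \<in> D" using k' by simp
qed

text \<open>Walking back from \<open>(k, l)\<close>, each step deletes one element:
  \<open>b l\<close> while the point is above the entry height of its column, otherwise
  \<open>a k\<close>. The deletions in reverse order list the ideal.\<close>

lemma path_linear_extension_aux:
  assumes "k \<le> m" "height D k \<le> l" "l \<le> height D (Suc k)"
  shows "\<exists>ws. distinct ws \<and> set ws = al k l \<and>
    prefix_sets ws = {al k' l' |k' l'. k' \<le> k \<and> l' \<le> l \<and> height D k' \<le> l' \<and> l' \<le> height D (Suc k')}"
  using assms
proof (induction "k + l" arbitrary: k l rule: less_induct)
  case less
  let ?Q = "\<lambda>k l. {al k' l' |k' l'. k' \<le> k \<and> l' \<le> l \<and> height D k' \<le> l' \<and> l' \<le> height D (Suc k')}"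
  have ln: "l \<le> n" using less.prems height_le[of "Suc k"] by simp
  consider "k = 0" "l = 0" | "height D k < l" | "k > 0" "l = height D k"
    using less.prems height_zero by force
  then show ?case
  proof cases
    case 1
    have "?Q 0 0 = {{}}" using height_zero by (auto simp: alpha_def)
    then show ?thesis using 1 by (intro exI[of _ "[]"]) (simp add: alpha_def)
  next
    case 2
    then obtain l0 where l0: "l = Suc l0" by (cases l) auto
    then obtain ws where ws: "distinct ws" "set ws = al k l0" "prefix_sets ws = ?Q k l0"
      using less.hyps[of k l0] less.prems 2 by auto
    have al: "insert (b l) (al k l0) = al k l" by (auto simp: alpha_def l0 atLeastAtMostSuc_conv)
    have "?Q k l = insert (al k l) (?Q k l0)"
    proof -
      have "x \<in> insert (al k l) (?Q k l0)" if xQ: "x \<in> ?Q k l" for x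
      proof -
        obtain k' l' where x: "x = al k' l'" "k' \<le> k" "l' \<le> l" "height D k' \<le> l'" "l' \<le> height D (Suc k')"
          using xQ by blast
        \<comment> \<open>In an earlier column the height \<open>l\<close> is out of reach:
          \<open>l' \<le> height D (Suc k') \<le> height D k < l\<close>.\<close>
        have "k' = k" if "l' = l"
          using that x 2 height_mono[of "Suc k'" k] less.prems by (cases "k' = k") auto
        then show ?thesis using x l0 by (cases "l' = l") auto
      qed
      moreover have "al k l \<in> ?Q k l" using less.prems by blast
      moreover have "?Q k l0 \<subseteq> ?Q k l" using l0 by (intro Collect_mono) (blast intro: le_SucI)
      ultimately show ?thesis by blast
    qed
    then have "prefix_sets (ws @ [b l]) = ?Q k l" by (simp add: prefix_sets_snoc ws al)
    moreover have "distinct (ws @ [b l])" "set (ws @ [b l]) = al k l"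
      using ws al b_mem_alpha[of l k l0] less.prems ln l0 by auto
    ultimately show ?thesis by blast
  next
    case 3
    then obtain k0 where k0: "k = Suc k0" by (cases k) auto
    have "height D k0 \<le> l" using height_mono[of k0 k] 3 k0 less.prems by simp
    then obtain ws where ws: "distinct ws" "set ws = al k0 l" "prefix_sets ws = ?Q k0 l"
      using less.hyps[of k0 l] less.prems 3 k0 by auto
    have al: "insert (a k) (al k0 l) = al k l" by (auto simp: alpha_def k0 atLeastAtMostSuc_conv)
    have "?Q k l = insert (al k l) (?Q k0 l)"
    proof -
      have "x \<in> insert (al k l) (?Q k0 l)" if xQ: "x \<in> ?Q k l" for x
      proof -
        obtain k' l' where x: "x = al k' l'" "k' \<le> k" "l' \<le> l" "height D k' \<le> l'" "l' \<le> height D (Suc k')"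
          using xQ by blast
        \<comment> \<open>In column \<open>k\<close> the bounds
          \<open>height D k \<le> l' \<le> l = height D k\<close> leave only the point
          \<open>(k, l)\<close>.\<close>
        then show ?thesis using k0 3 by (cases "k' = k") auto
      qed
      moreover have "al k l \<in> ?Q k l" using less.prems by blast
      moreover have "?Q k0 l \<subseteq> ?Q k l" using k0 by (intro Collect_mono) (blast intro: le_SucI)
      ultimately show ?thesis by blast
    qed
    then have "prefix_sets (ws @ [a k]) = ?Q k l" by (simp add: prefix_sets_snoc ws al)
    moreover have "distinct (ws @ [a k])" "set (ws @ [a k]) = al k l"
      using ws al a_mem_alpha[of k k0 l] less.prems ln k0 by auto
    ultimately show ?thesis by blast
  qed
qed

lemma path_linear_extension:
  obtains ws where "distinct ws" "set ws = P" "prefix_sets ws = path_ideals D"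
proof -
  have n: "height D (Suc m) = n" by (simp add: height_def)
  have "height D m \<le> n" using height_le by simp
  then obtain ws where ws: "distinct ws" "set ws = al m n"
    "prefix_sets ws = {al k' l' |k' l'. k' \<le> m \<and> l' \<le> n \<and> height D k' \<le> l' \<and> l' \<le> height D (Suc k')}"
    using path_linear_extension_aux[of m n] n by auto
  have "al m n = P" by (simp add: alpha_def P_eq)
  moreover have "prefix_sets ws = path_ideals D"
  proof -
    have "l' \<le> n" if "k' \<le> m" "l' \<le> height D (Suc k')" for k' l'
      using height_le[of "Suc k'"] that by simp
    then show ?thesis unfolding ws(3) path_ideals_def by (intro Collect_cong) blast
  qed
  ultimately show ?thesis using that ws by simp
qed

end

text \<open>The lowest point of the path in column \<open>k\<close> has height
  \<open>height D k\<close>. So the path determines the heights, and these determine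
  \<open>D\<close> by \<open>mem_iff_height\<close>.\<close>

lemma path_ideals_inj:
  assumes D: "D \<subseteq> S_pairs P r m a n b" "increasing_pairs D"
    and D': "D' \<subseteq> S_pairs P r m a n b" "increasing_pairs D'"
    and eq: "path_ideals D = path_ideals D'"
  shows "D = D'"
proof -
  have h: "height D k = height D' k" if "k \<le> m" for k
  proof (rule le_antisym)
    have bd: "height D k \<le> n" "height D' k \<le> n"
      using height_le[OF D] height_le[OF D'] that by auto
    show "height D k \<le> height D' k"
      using mem_path_ideals[OF D that bd(2)] mem_path_ideals[OF D' that bd(2)] height_Suc_ge[OF D' that] eq by simp
    show "height D' k \<le> height D k"
      using mem_path_ideals[OF D that bd(1)] mem_path_ideals[OF D' that bd(1)] height_Suc_ge[OF D that] eq by simp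
  qed
  show ?thesis
    using mem_iff_height[OF D] mem_iff_height[OF D'] h by (auto simp: set_eq_iff)
qed

end

section \<open>Linear forms and their initial exponents\<close>

text \<open>\<open>theta\<close>, \<open>theta0\<close> and the partial sums behind the quadratic
  initial terms all have the shape of such a form minus a constant.\<close>

definition linear_form :: "('v \<Rightarrow> 'k) \<Rightarrow> 'v set \<Rightarrow> ('v, 'k::field) mpoly" where
  "linear_form \<xi> S = (\<Sum>v\<in>S. Const (\<xi> v) * Var v)"

lemma theta_eq: "theta B \<xi> \<eta> c = linear_form \<xi> {\<alpha>\<in>B. c \<in> \<alpha>} - Const (\<eta> c)"
  by (simp add: theta_def linear_form_def)

lemma theta0_eq: "theta0 B \<xi> \<eta>0 = linear_form \<xi> B - Const \<eta>0"
  by (simp add: theta0_def linear_form_def)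

lemma linear_form_single: "linear_form \<xi> S = (\<Sum>v\<in>S. Poly_Mapping.single (Poly_Mapping.single v 1) (\<xi> v))"
  by (simp add: linear_form_def Const_def Var_def mult_single)

lemma single_key_eq_iff: "(k::nat) \<noteq> 0 \<Longrightarrow> Poly_Mapping.single u k = Poly_Mapping.single v k \<longleftrightarrow> u = v"
  by (metis lookup_single_eq lookup_single_not_eq)

lemma single_neq_0: "(k::nat) \<noteq> 0 \<Longrightarrow> Poly_Mapping.single u k \<noteq> 0"
  by (metis lookup_single_eq lookup_zero)

lemma Var_neq_0: "(Var v :: ('v, 'k::zero_neq_one) mpoly) \<noteq> 0"
  unfolding Var_def by (metis lookup_single_eq lookup_zero zero_neq_one)

lemma Var_eq_iff: "(Var v :: ('v, 'k::zero_neq_one) mpoly) = Var w \<longleftrightarrow> v = w"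
  unfolding Var_def
  by (metis lookup_single_eq lookup_single_not_eq single_key_eq_iff zero_neq_one)

lemma linear_form_in_poly_ring: "S \<subseteq> X \<Longrightarrow> linear_form \<xi> S \<in> poly_ring X"
  unfolding linear_form_single by (intro poly_ring_sum poly_ring_single) auto

lemma eval_linear_form:
  "eval_mpoly (\<lambda>x. x) z (linear_form \<xi> S - Const c) = (\<Sum>v\<in>S. \<xi> v * z v) - c"
  by (simp add: linear_form_single eval_mpoly_diff eval_mpoly_sum eval_mpoly_single eval_mpoly_Const)

lemma grevlex_lessI:
  assumes "deg_mon m = deg_mon n" "Poly_Mapping.lookup n v < Poly_Mapping.lookup m v"
    and "\<And>w. (w, v) \<in> lt \<Longrightarrow> Poly_Mapping.lookup m w = Poly_Mapping.lookup n w"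
  shows "grevlex_less lt m n"
  using assms by (auto simp: grevlex_less_def)

context monomial_order
begin

lemma is_initial_exponent_linear_form:
  assumes S: "S \<subseteq> X" and v: "v \<in> S" "\<xi> v \<noteq> 0" and min: "\<And>w. w \<in> S \<Longrightarrow> w \<noteq> v \<Longrightarrow> (w, v) \<in> lt"
  shows "is_initial_exponent lt (linear_form \<xi> S - Const c) (Poly_Mapping.single v 1)"
proof -
  have finS: "finite S" using S fin finite_subset by blast
  have "Poly_Mapping.lookup (linear_form \<xi> S - Const c) (Poly_Mapping.single v 1) =
      (\<Sum>w\<in>S. if w = v then \<xi> w else 0)"
    using single_neq_0[of 1 v]
    by (auto simp: linear_form_single Const_def lookup_minus lookup_sum lookup_single when_def
        single_key_eq_iff intro!: sum.cong)
  also have "\<dots> = \<xi> v" using v finS by simp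
  finally have "Poly_Mapping.single v 1 \<in> Poly_Mapping.keys (linear_form \<xi> S - Const c)"
    using v by (simp add: in_keys_iff)
  moreover have "grevlex_less lt n (Poly_Mapping.single v 1)"
    if n: "n \<in> Poly_Mapping.keys (linear_form \<xi> S - Const c)" "n \<noteq> Poly_Mapping.single v 1" for n
  proof (cases "n = 0")
    case True
    then show ?thesis by (simp add: grevlex_less_def)
  next
    case False
    then have "Poly_Mapping.lookup (linear_form \<xi> S) n \<noteq> 0"
      using n by (auto simp: in_keys_iff lookup_minus Const_def lookup_single when_def)
    moreover have "Poly_Mapping.lookup (linear_form \<xi> S) n = 0" if "\<forall>w\<in>S. n \<noteq> Poly_Mapping.single w 1"
      unfolding linear_form_single lookup_sum
      by (rule sum.neutral) (use that in \<open>auto simp: lookup_single when_def\<close>)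
    ultimately obtain w where w: "w \<in> S" "n = Poly_Mapping.single w 1" by blast
    then have "(w, v) \<in> lt" using n min by auto
    then show ?thesis
      \<comment> \<open>The smaller variable \<open>w\<close> is the witness: it occurs only in
        \<open>n\<close>, and no variable below it occurs on either side.\<close>
      using w lt_irrefl lt_asym by (intro grevlex_lessI[of _ _ w]) (auto simp: lookup_single when_def)
  qed
  ultimately show ?thesis by (simp add: is_initial_exponent_def)
qed

end

section \<open>The toric ideal\<close>

text \<open>The exponent vector of the image of \<open>m\<close> under the toric map; the sum over
  \<open>j\<close> accounts for the multiplicity of \<alpha> in \<open>m\<close>.\<close>

definition toric_exponent :: "('a set \<Rightarrow>\<^sub>0 nat) \<Rightarrow> ('a tvar \<Rightarrow>\<^sub>0 nat)" where
  "toric_exponent m = (\<Sum>\<alpha>\<in>Poly_Mapping.keys m. \<Sum>j<Poly_Mapping.lookup m \<alpha>.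
     (\<Sum>c\<in>\<alpha>. Poly_Mapping.single (T_of c) 1) + Poly_Mapping.single T_sigma 1)"

lemma lookup_toric_exponent_T_of:
  assumes "finite B" "\<And>\<alpha>. \<alpha> \<in> B \<Longrightarrow> finite \<alpha>" "Poly_Mapping.keys m \<subseteq> B"
  shows "Poly_Mapping.lookup (toric_exponent m) (T_of c) = (\<Sum>\<alpha>\<in>{\<alpha>\<in>B. c \<in> \<alpha>}. Poly_Mapping.lookup m \<alpha>)"
proof -
  have "Poly_Mapping.lookup (toric_exponent m) (T_of c) =
      (\<Sum>\<alpha>\<in>Poly_Mapping.keys m. if c \<in> \<alpha> then Poly_Mapping.lookup m \<alpha> else 0)"
    unfolding toric_exponent_def lookup_sum lookup_add
  proof (intro sum.cong refl)
    fix \<alpha> assume "\<alpha> \<in> Poly_Mapping.keys m"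
    then have "finite \<alpha>" using assms by auto
    then have "(\<Sum>d\<in>\<alpha>. Poly_Mapping.lookup (Poly_Mapping.single (T_of d) 1) (T_of c)) = (if c \<in> \<alpha> then 1 else (0::nat))"
      by (simp add: lookup_single when_def)
    then show "(\<Sum>j<Poly_Mapping.lookup m \<alpha>. (\<Sum>d\<in>\<alpha>. Poly_Mapping.lookup (Poly_Mapping.single (T_of d) 1) (T_of c)) +
        Poly_Mapping.lookup (Poly_Mapping.single T_sigma 1) (T_of c)) = (if c \<in> \<alpha> then Poly_Mapping.lookup m \<alpha> else 0)"
      by (simp add: lookup_single when_def)
  qed
  also have "\<dots> = (\<Sum>\<alpha>\<in>B. if c \<in> \<alpha> then Poly_Mapping.lookup m \<alpha> else 0)"
    by (rule sum.mono_neutral_left) (use assms in \<open>auto simp: in_keys_iff\<close>)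
  also have "\<dots> = (\<Sum>\<alpha>\<in>{\<alpha>\<in>B. c \<in> \<alpha>}. Poly_Mapping.lookup m \<alpha>)"
    using assms(1) by (simp add: sum.inter_filter)
  finally show ?thesis .
qed

lemma lookup_toric_exponent_T_sigma: "Poly_Mapping.lookup (toric_exponent m) T_sigma = deg_mon m"
  unfolding toric_exponent_def lookup_sum lookup_add deg_mon_def
  by (simp add: lookup_single when_def)

lemma mon_eval_toric:
  assumes "\<And>\<alpha>. \<alpha> \<in> Poly_Mapping.keys m \<Longrightarrow> finite \<alpha>"
  shows "mon_eval (\<lambda>\<alpha>. (\<Prod>c\<in>\<alpha>. Var (T_of c)) * Var T_sigma) m =
    (Poly_Mapping.single (toric_exponent m) 1 :: ('a tvar, 'k::field) mpoly)"
proof -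
  let ?e = "\<lambda>\<alpha>. (\<Sum>c\<in>\<alpha>. Poly_Mapping.single (T_of c) 1) + Poly_Mapping.single T_sigma (1::nat)"
  have e: "(\<Prod>c\<in>\<alpha>. Var (T_of c)) * Var T_sigma = (Poly_Mapping.single (?e \<alpha>) 1 :: ('a tvar, 'k) mpoly)"
    if "finite \<alpha>" for \<alpha> :: "'a set"
    using that by (simp add: Var_def prod_single_one mult_single)
  have pow: "Poly_Mapping.single w 1 ^ k = (Poly_Mapping.single (\<Sum>j<k. w) 1 :: ('a tvar, 'k) mpoly)" for w k
    using prod_single_one[of "{..<k}" "\<lambda>_. w", where ?'k = 'k] by simp
  have "mon_eval (\<lambda>\<alpha>. (\<Prod>c\<in>\<alpha>. Var (T_of c)) * Var T_sigma) m =
      (\<Prod>\<alpha>\<in>Poly_Mapping.keys m. Poly_Mapping.single (\<Sum>j<Poly_Mapping.lookup m \<alpha>. ?e \<alpha>) (1::'k))"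
    unfolding mon_eval_def by (rule prod.cong) (use assms e pow in auto)
  then show ?thesis by (simp add: prod_single_one toric_exponent_def)
qed

text \<open>The toric map sends monomials to monomials and keeps coefficients, so the image of the
  term at \<open>m\<close> can only be cancelled by a term with the same image.\<close>

lemma toric_exponent_collision:
  assumes f: "(f :: ('a set, 'k::field) mpoly) \<in> toric_ideal B" and B: "\<And>\<alpha>. \<alpha> \<in> B \<Longrightarrow> finite \<alpha>"
    and m: "m \<in> Poly_Mapping.keys f"
  obtains n where "n \<in> Poly_Mapping.keys f" "n \<noteq> m" "toric_exponent n = toric_exponent m"
proof -
  have keys: "\<And>n. n \<in> Poly_Mapping.keys f \<Longrightarrow> Poly_Mapping.keys n \<subseteq> B"
    and ev: "eval_mpoly Const (\<lambda>\<alpha>. (\<Prod>c\<in>\<alpha>. Var (T_of c)) * Var T_sigma :: ('a tvar, 'k) mpoly) f = 0"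
    using f by (auto simp: toric_ideal_def poly_ring_def)
  have "eval_mpoly Const (\<lambda>\<alpha>. (\<Prod>c\<in>\<alpha>. Var (T_of c)) * Var T_sigma :: ('a tvar, 'k) mpoly) f =
      (\<Sum>n\<in>Poly_Mapping.keys f. Poly_Mapping.single (toric_exponent n) (Poly_Mapping.lookup f n))"
    unfolding eval_mpoly_def mon_eval_def[symmetric]
  proof (intro sum.cong refl)
    fix n assume "n \<in> Poly_Mapping.keys f"
    then have "mon_eval (\<lambda>\<alpha>. (\<Prod>c\<in>\<alpha>. Var (T_of c)) * Var T_sigma) n =
        (Poly_Mapping.single (toric_exponent n) 1 :: ('a tvar, 'k) mpoly)"
      using keys B by (intro mon_eval_toric) blast
    then show "Const (Poly_Mapping.lookup f n) * mon_eval (\<lambda>\<alpha>. (\<Prod>c\<in>\<alpha>. Var (T_of c)) * Var T_sigma) n =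
        (Poly_Mapping.single (toric_exponent n) (Poly_Mapping.lookup f n) :: ('a tvar, 'k) mpoly)"
      by (simp add: Const_def mult_single)
  qed
  then have "Poly_Mapping.lookup (\<Sum>n\<in>Poly_Mapping.keys f.
      Poly_Mapping.single (toric_exponent n) (Poly_Mapping.lookup f n)) (toric_exponent m) = 0"
    by (simp add: ev)
  then have "0 = (\<Sum>n\<in>Poly_Mapping.keys f. if toric_exponent n = toric_exponent m then Poly_Mapping.lookup f n else 0)"
    by (simp add: lookup_sum lookup_single when_def)
  then have zero: "0 = Poly_Mapping.lookup f m +
      (\<Sum>n\<in>Poly_Mapping.keys f - {m}. if toric_exponent n = toric_exponent m then Poly_Mapping.lookup f n else 0)"
    using m by (simp add: sum.remove)
  show ?thesis
  proof (rule ccontr)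
    assume "\<not> thesis"
    then have "\<forall>n\<in>Poly_Mapping.keys f - {m}. toric_exponent n \<noteq> toric_exponent m" using that by blast
    then have "(\<Sum>n\<in>Poly_Mapping.keys f - {m}. if toric_exponent n = toric_exponent m then Poly_Mapping.lookup f n else 0) = 0"
      by (intro sum.neutral) auto
    then show False using zero m by (simp add: in_keys_iff)
  qed
qed

section \<open>The bouquet\<close>

locale two_chain_bouquet =
  fixes q :: nat
    and P :: "nat \<Rightarrow> 'a set" and r :: "nat \<Rightarrow> 'a rel"
    and p s :: "nat \<Rightarrow> nat" and a b :: "nat \<Rightarrow> nat \<Rightarrow> 'a"
    and \<iota> :: "complex \<Rightarrow> 'k::field"
    and \<xi> :: "'a set \<Rightarrow> 'k" and \<eta> :: "'a \<Rightarrow> 'k" and \<eta>0 :: 'k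
    and lt :: "'a set rel"
  assumes q: "1 \<le> q"
    and order: "\<And>i. i \<in> {1..q} \<Longrightarrow> partial_order_on (P i) (r i)"
    and disjoint: "disjoint_family_on P {1..q}"
    and chains: "\<And>i. i \<in> {1..q} \<Longrightarrow> two_chains (P i) (r i) (p i) (a i) (s i) (b i)"
    and generic: "rational_function_field \<iota> (indets (bouquet q P r) (\<Union>i\<in>{1..q}. P i)) (case_indet \<xi> \<eta> \<eta>0)"
    and linear: "strict_linear_order_on (bouquet q P r) lt"
    and compatible: "\<And>i \<alpha> \<beta>. \<lbrakk>i \<in> {1..q}; \<alpha> \<in> poset_ideals (P i) (r i); \<beta> \<in> poset_ideals (P i) (r i); \<beta> \<subset> \<alpha>\<rbrakk>
           \<Longrightarrow> (\<alpha>, \<beta>) \<in> lt"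
begin

abbreviation "B \<equiv> bouquet q P r"
abbreviation "C \<equiv> \<Union>i\<in>{1..q}. P i"
abbreviation "I \<equiv> {1..q}"
abbreviation "L i \<equiv> poset_ideals (P i) (r i)"
abbreviation "A i \<equiv> ideal_pairs (P i) (r i) (p i) (a i) (s i) (b i)"
abbreviation "al i \<equiv> alpha (a i) (b i)"
abbreviation "S i \<equiv> S_pairs (P i) (r i) (p i) (a i) (s i) (b i)"
abbreviation "J \<equiv> J_ideal B C lt \<xi> \<eta> \<eta>0"
abbreviation "T \<equiv> initial_ideal B lt (toric_ideal B :: ('a set, 'k) mpoly set)"

lemma two_chain: "i \<in> I \<Longrightarrow> two_chain_poset (P i) (r i) (p i) (a i) (s i) (b i)"
  using order chains by unfold_locales

lemma L_subset: "\<alpha> \<in> L i \<Longrightarrow> \<alpha> \<subseteq> P i"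
  by (auto simp: poset_ideals_def)

lemma L_in_B: "i \<in> I \<Longrightarrow> \<alpha> \<in> L i \<Longrightarrow> \<alpha> \<in> B"
  by (auto simp: bouquet_def)

lemma finite_P: "i \<in> I \<Longrightarrow> finite (P i)"
  using two_chain two_chain_poset.finite_P by blast

lemma finite_B: "finite B"
proof -
  have "finite (L i)" if "i \<in> I" for i
    by (rule finite_subset[of _ "Pow (P i)"]) (use finite_P that L_subset in auto)
  then show ?thesis by (auto simp: bouquet_def)
qed

lemma finite_ideal: "\<alpha> \<in> B \<Longrightarrow> finite \<alpha>"
  using L_subset finite_P finite_subset by (fastforce simp: bouquet_def)

sublocale monomial_order B lt
  using finite_B linear by unfold_locales

lemma empty_in_L: "{} \<in> L i"
  by (simp add: poset_ideals_def)

lemma empty_in_B: "{} \<in> B"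
  using L_in_B[of 1] empty_in_L q by simp

lemma P_disjoint: "i \<in> I \<Longrightarrow> j \<in> I \<Longrightarrow> c \<in> P i \<Longrightarrow> c \<in> P j \<Longrightarrow> i = j"
  using disjoint unfolding disjoint_family_on_def by blast

text \<open>Consequently the sum in \<open>theta c\<close>, although taken over the whole bouquet,
  involves the ideals of one poset only.\<close>

lemma B_in_L: "i \<in> I \<Longrightarrow> \<alpha> \<in> B \<Longrightarrow> c \<in> \<alpha> \<Longrightarrow> c \<in> P i \<Longrightarrow> \<alpha> \<in> L i"
proof -
  assume *: "i \<in> I" "\<alpha> \<in> B" "c \<in> \<alpha>" "c \<in> P i"
  then obtain j where "j \<in> I" "\<alpha> \<in> L j" unfolding bouquet_def by blast
  then show ?thesis using * L_subset P_disjoint[of i j c] by blast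
qed

lemma B_cases:
  assumes "\<alpha> \<in> B"
  obtains i k l where "i \<in> I" "(k, l) \<in> A i" "\<alpha> = al i k l"
  using assms two_chain_poset.ideal_eq_alpha[OF two_chain] unfolding bouquet_def by blast

lemma al_in_L: "(k, l) \<in> A i \<Longrightarrow> al i k l \<in> L i"
  by (simp add: ideal_pairs_def)

lemma al_in_B: "i \<in> I \<Longrightarrow> (k, l) \<in> A i \<Longrightarrow> al i k l \<in> B"
  using L_in_B al_in_L by blast

lemma lt_empty: "\<alpha> \<in> B \<Longrightarrow> \<alpha> \<noteq> {} \<Longrightarrow> (\<alpha>, {}) \<in> lt"
proof -
  assume *: "\<alpha> \<in> B" "\<alpha> \<noteq> {}"
  then obtain i where "i \<in> I" "\<alpha> \<in> L i" unfolding bouquet_def by blast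
  then show ?thesis using compatible[of i \<alpha> "{}"] empty_in_L * by blast
qed

text \<open>Algebraic independence of the indeterminates. Applied below to single variables and to a
  difference of two, it shows that the \<xi> and \<eta> are nonzero and the \<eta> distinct.\<close>

lemma eval_nonzero: "f \<in> poly_ring (indets B C) \<Longrightarrow> f \<noteq> 0 \<Longrightarrow> eval_mpoly \<iota> (case_indet \<xi> \<eta> \<eta>0) f \<noteq> 0"
  using generic by (auto simp: rational_function_field_def)

lemma \<iota>: "\<iota> 1 = 1" "\<iota> (x + y) = \<iota> x + \<iota> y" "\<iota> (x * y) = \<iota> x * \<iota> y" "\<iota> 0 = 0"
proof -
  show "\<iota> 1 = 1" and add: "\<iota> (x + y) = \<iota> x + \<iota> y" and "\<iota> (x * y) = \<iota> x * \<iota> y" for x y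
    using generic by (auto simp: rational_function_field_def)
  show "\<iota> 0 = 0" using add[of 0 0] by (metis add_0 add_cancel_right_right)
qed

lemma \<xi>_nonzero: "\<alpha> \<in> B \<Longrightarrow> \<xi> \<alpha> \<noteq> 0"
proof -
  assume "\<alpha> \<in> B"
  then have "(Var (Xi \<alpha>) :: (_, complex) mpoly) \<in> poly_ring (indets B C)"
    by (intro poly_ring_Var) (auto simp: indets_def)
  then show ?thesis using eval_nonzero Var_neq_0 by (fastforce simp: eval_mpoly_Var \<iota>)
qed

lemma \<eta>_nonzero: "c \<in> C \<Longrightarrow> \<eta> c \<noteq> 0"
proof -
  assume "c \<in> C"
  then have "(Var (Eta c) :: (_, complex) mpoly) \<in> poly_ring (indets B C)"
    by (intro poly_ring_Var) (auto simp: indets_def)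
  then show ?thesis using eval_nonzero Var_neq_0 by (fastforce simp: eval_mpoly_Var \<iota>)
qed

lemma \<eta>_inj: "inj_on \<eta> C"
proof (rule inj_onI, rule ccontr)
  fix c d assume cd: "c \<in> C" "d \<in> C" "\<eta> c = \<eta> d" "c \<noteq> d"
  have "Var (Eta c) - (Var (Eta d) :: (_, complex) mpoly) \<in> poly_ring (indets B C)"
    using cd by (intro poly_ring_diff poly_ring_Var) (auto simp: indets_def)
  moreover have "Var (Eta c) - (Var (Eta d) :: (_, complex) mpoly) \<noteq> 0"
    using cd by (simp add: Var_eq_iff)
  ultimately have "eval_mpoly \<iota> (case_indet \<xi> \<eta> \<eta>0) (Var (Eta c) - Var (Eta d)) \<noteq> 0"
    by (rule eval_nonzero)
  then show False using cd by (simp add: eval_mpoly_diff \<iota> eval_mpoly_Var)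
qed

subsection \<open>The initial ideal of the toric ideal\<close>

text \<open>The binomial replacing \<alpha>, \<beta> by their union and intersection is toric. The
  union is the smallest variable involved, so the reverse lexicographic order makes the term
  containing it the smaller one.\<close>

lemma incomparable_in_initial:
  assumes i: "i \<in> I" and L: "\<alpha> \<in> L i" "\<beta> \<in> L i" and inc: "\<not> \<alpha> \<subseteq> \<beta>" "\<not> \<beta> \<subseteq> \<alpha>"
  shows "Var \<alpha> * Var \<beta> \<in> T"
proof -
  have L': "\<alpha> \<union> \<beta> \<in> L i" "\<alpha> \<inter> \<beta> \<in> L i" using L by (auto simp: poset_ideals_def)
  have B: "\<alpha> \<in> B" "\<beta> \<in> B" "\<alpha> \<union> \<beta> \<in> B" "\<alpha> \<inter> \<beta> \<in> B" using L L' L_in_B[OF i] by auto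
  let ?M = "Poly_Mapping.single \<alpha> 1 + Poly_Mapping.single \<beta> (1::nat)"
  let ?N = "Poly_Mapping.single (\<alpha> \<union> \<beta>) 1 + Poly_Mapping.single (\<alpha> \<inter> \<beta>) (1::nat)"
  let ?f = "Var \<alpha> * Var \<beta> - Var (\<alpha> \<union> \<beta>) * Var (\<alpha> \<inter> \<beta>) :: ('a set, 'k) mpoly"
  have f: "?f = Poly_Mapping.single ?M 1 - Poly_Mapping.single ?N 1"
    by (simp add: Var_def mult_single)
  have "eval_mpoly Const (\<lambda>\<alpha>. (\<Prod>c\<in>\<alpha>. Var (T_of c)) * Var T_sigma :: ('a tvar, 'k) mpoly) ?f = 0"
    using prod.union_inter[of \<alpha> \<beta> "\<lambda>c. Var (T_of c) :: ('a tvar, 'k) mpoly"] B[THEN finite_ideal]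
    by (simp add: eval_mpoly_diff eval_mpoly_mult eval_mpoly_Var Const_def single_add mult_single ac_simps)
  moreover have "?f \<in> poly_ring B"
    using B by (intro poly_ring_diff poly_ring_mult poly_ring_Var)
  ultimately have "?f \<in> toric_ideal B" by (simp add: toric_ideal_def)
  moreover have less: "grevlex_less lt ?N ?M"
  proof (rule grevlex_lessI[of _ _ "\<alpha> \<union> \<beta>"])
    have "\<alpha> \<subset> \<alpha> \<union> \<beta>" "\<beta> \<subset> \<alpha> \<union> \<beta>" "\<alpha> \<inter> \<beta> \<subset> \<alpha> \<union> \<beta>" using inc by auto
    then have lt: "(\<alpha> \<union> \<beta>, \<alpha>) \<in> lt" "(\<alpha> \<union> \<beta>, \<beta>) \<in> lt" "(\<alpha> \<union> \<beta>, \<alpha> \<inter> \<beta>) \<in> lt"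
      using compatible[OF i L'(1)] L L' by auto
    have neq: "\<alpha> \<noteq> \<alpha> \<union> \<beta>" "\<beta> \<noteq> \<alpha> \<union> \<beta>" using inc by auto
    show "Poly_Mapping.lookup ?M (\<alpha> \<union> \<beta>) < Poly_Mapping.lookup ?N (\<alpha> \<union> \<beta>)"
      using neq by (simp add: lookup_add lookup_single when_def)
    fix \<gamma> assume "(\<gamma>, \<alpha> \<union> \<beta>) \<in> lt"
    then have "\<gamma> \<noteq> \<alpha>" "\<gamma> \<noteq> \<beta>" "\<gamma> \<noteq> \<alpha> \<union> \<beta>" "\<gamma> \<noteq> \<alpha> \<inter> \<beta>"
      using lt lt_asym lt_irrefl by blast+
    then show "Poly_Mapping.lookup ?N \<gamma> = Poly_Mapping.lookup ?M \<gamma>"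
      by (simp add: lookup_add lookup_single when_def)
  qed (simp add: deg_mon_add)
  moreover have "is_initial_exponent lt ?f ?M"
  proof -
    have "?N \<noteq> ?M" using less by (metis grevlex_less_irrefl)
    then have "?M \<in> Poly_Mapping.keys ?f"
      unfolding f by (simp add: in_keys_iff lookup_minus lookup_single when_def)
    moreover have "Poly_Mapping.keys ?f \<subseteq> {?M, ?N}"
      unfolding f using keys_diff[of "Poly_Mapping.single ?M (1::'k)" "Poly_Mapping.single ?N 1"] by auto
    ultimately show ?thesis using less by (auto simp: is_initial_exponent_def)
  qed
  ultimately have "Poly_Mapping.single (0 + ?M) (1::'k) \<in> T" by (intro initial_idealI) auto
  then show ?thesis by (simp add: Var_def mult_single)
qed

text \<open>A monomial whose factors form chains is the smallest one with its toric image, whereas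
  cancellation in \<open>f\<close> yields a smaller \<open>n\<close> with the same image. The image
  fixes the degree and, for each \<open>c\<close>, the number of factors containing
  \<open>c\<close>.\<close>

lemma initial_exponent_toric:
  assumes f: "f \<in> (toric_ideal B :: ('a set, 'k) mpoly set)" and m: "is_initial_exponent lt f m"
  shows "\<exists>i\<in>I. \<exists>\<alpha>\<in>L i \<inter> Poly_Mapping.keys m. \<exists>\<beta>\<in>L i \<inter> Poly_Mapping.keys m. \<not> \<alpha> \<subseteq> \<beta> \<and> \<not> \<beta> \<subseteq> \<alpha>"
proof (rule ccontr)
  assume "\<not> ?thesis"
  then have chain: "\<alpha> \<subseteq> \<beta> \<or> \<beta> \<subseteq> \<alpha>"
    if "i \<in> I" "\<alpha> \<in> L i" "\<beta> \<in> L i" "\<alpha> \<in> Poly_Mapping.keys m" "\<beta> \<in> Poly_Mapping.keys m" for i \<alpha> \<beta>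
    using that by blast
  have m_in: "m \<in> Poly_Mapping.keys f" using m by (simp add: is_initial_exponent_def)
  obtain n where n: "n \<in> Poly_Mapping.keys f" "n \<noteq> m" "toric_exponent n = toric_exponent m"
    using toric_exponent_collision[OF f finite_ideal m_in] by blast
  have keys: "Poly_Mapping.keys n \<subseteq> B" "Poly_Mapping.keys m \<subseteq> B"
    using f n m_in by (auto simp: toric_ideal_def poly_ring_def)
  have deg: "deg_mon n = deg_mon m"
    using n(3) lookup_toric_exponent_T_sigma by metis
  have T_of: "(\<Sum>\<beta>\<in>{\<beta>\<in>B. c \<in> \<beta>}. Poly_Mapping.lookup n \<beta>) = (\<Sum>\<beta>\<in>{\<beta>\<in>B. c \<in> \<beta>}. Poly_Mapping.lookup m \<beta>)" for c
    using n(3) lookup_toric_exponent_T_of[OF finite_B finite_ideal keys(1)]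
      lookup_toric_exponent_T_of[OF finite_B finite_ideal keys(2)] by simp
  have "grevlex_less lt n m" using m n by (simp add: is_initial_exponent_def)
  then obtain \<alpha> where \<alpha>: "Poly_Mapping.lookup m \<alpha> < Poly_Mapping.lookup n \<alpha>"
    and eq: "\<And>\<beta>. (\<beta>, \<alpha>) \<in> lt \<Longrightarrow> Poly_Mapping.lookup n \<beta> = Poly_Mapping.lookup m \<beta>"
    using deg by (auto simp: grevlex_less_def)
  then have \<alpha>B: "\<alpha> \<in> B" using keys by (auto simp: in_keys_iff)
  show False
  proof (cases "\<alpha> = {}")
    case True
    \<comment> \<open>The empty ideal is the largest variable: if it decides, \<open>n\<close>
      agrees with \<open>m\<close> elsewhere and has larger degree.\<close>
    have "Poly_Mapping.lookup m \<beta> \<le> Poly_Mapping.lookup n \<beta>" if "\<beta> \<in> B" for \<beta>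
      using lt_empty[OF that] eq \<alpha> True by (cases "\<beta> = {}") auto
    then have "(\<Sum>\<beta>\<in>B. Poly_Mapping.lookup m \<beta>) < (\<Sum>\<beta>\<in>B. Poly_Mapping.lookup n \<beta>)"
      using \<alpha> \<alpha>B finite_B by (intro sum_strict_mono_ex1) auto
    then show False using deg keys finite_B by (simp add: deg_mon_superset[of B])
  next
    case False
    obtain i where i: "i \<in> I" "\<alpha> \<in> L i" using \<alpha>B unfolding bouquet_def by blast
    \<comment> \<open>If all factors of \<open>m\<close> through \<open>c\<close> contained
      \<alpha>, then those other than \<alpha> would be smaller variables, with equal exponents in
      \<open>n\<close>, while \<open>n\<close> has more of \<alpha>. The counts at \<open>c\<close>
      would differ.\<close>
    have ex: "\<exists>\<beta>\<in>Poly_Mapping.keys m. \<beta> \<in> L i \<and> c \<in> \<beta> \<and> \<not> \<alpha> \<subseteq> \<beta>" if c: "c \<in> \<alpha>" for c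
    proof (rule ccontr)
      assume no: "\<not> ?thesis"
      have "c \<in> P i" using L_subset i c by auto
      have "Poly_Mapping.lookup m \<beta> \<le> Poly_Mapping.lookup n \<beta>" if \<beta>: "\<beta> \<in> B" "c \<in> \<beta>" for \<beta>
      proof (cases "\<beta> \<in> Poly_Mapping.keys m \<and> \<beta> \<noteq> \<alpha>")
        case True
        have "\<beta> \<in> L i" using B_in_L i \<beta> \<open>c \<in> P i\<close> by blast
        then have "\<alpha> \<subset> \<beta>" using no True \<beta> by blast
        then show ?thesis using compatible[OF i(1) \<open>\<beta> \<in> L i\<close> i(2)] eq by simp
      qed (use \<alpha> in \<open>auto simp: in_keys_iff\<close>)
      then have "(\<Sum>\<beta>\<in>{\<beta>\<in>B. c \<in> \<beta>}. Poly_Mapping.lookup m \<beta>) < (\<Sum>\<beta>\<in>{\<beta>\<in>B. c \<in> \<beta>}. Poly_Mapping.lookup n \<beta>)"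
        using \<alpha> \<alpha>B finite_B c by (intro sum_strict_mono_ex1) auto
      then show False using T_of by simp
    qed
    \<comment> \<open>These factors together cover \<alpha> and form a chain, so the largest of them
      contains \<alpha>, against the choice of \<open>K\<close>.\<close>
    define K where "K = {\<beta> \<in> Poly_Mapping.keys m. \<beta> \<in> L i \<and> \<not> \<alpha> \<subseteq> \<beta>}"
    have "finite K" "K \<noteq> {}" using ex False by (auto simp: K_def)
    then obtain M where M: "M \<in> K" "\<And>\<beta>. \<beta> \<in> K \<Longrightarrow> M \<subseteq> \<beta> \<Longrightarrow> M = \<beta>"
      using finite_has_maximal by metis
    have "\<beta> \<subseteq> M" if "\<beta> \<in> K" for \<beta>
      using chain[OF i(1), of \<beta> M] M that by (auto simp: K_def)
    then have "\<alpha> \<subseteq> M" using ex by (fastforce simp: K_def)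
    then show False using M by (simp add: K_def)
  qed
qed

lemma initial_toric_in_poly_ring: "T \<subseteq> poly_ring B"
proof
  fix g assume g: "g \<in> T"
  have "Poly_Mapping.keys m \<subseteq> B" if m: "m \<in> Poly_Mapping.keys g" for m
  proof -
    obtain f n k where *: "f \<in> (toric_ideal B :: ('a set, 'k) mpoly set)" "is_initial_exponent lt f n"
      "m = k + n" "Poly_Mapping.keys k \<subseteq> B"
      using keys_initial_ideal[OF g m] by blast
    then have "Poly_Mapping.keys n \<subseteq> B"
      by (auto simp: toric_ideal_def poly_ring_def is_initial_exponent_def)
    then show ?thesis using * keys_add[of k n] by auto
  qed
  then show "g \<in> poly_ring B" by (simp add: poly_ring_def)
qed

subsection \<open>Initial monomials of the ideal\<close>

lemma theta_in_J: "c \<in> C \<Longrightarrow> theta B \<xi> \<eta> c \<in> J"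
  unfolding J_ideal_def by (rule poly_ideal_gen) blast

lemma theta0_in_J: "theta0 B \<xi> \<eta>0 \<in> J"
  unfolding J_ideal_def by (rule poly_ideal_gen) blast

lemma T_in_J: "f \<in> T \<Longrightarrow> f \<in> J"
  unfolding J_ideal_def by (rule poly_ideal_gen) blast

lemma J_mult: "f \<in> poly_ring B \<Longrightarrow> g \<in> J \<Longrightarrow> f * g \<in> J"
  unfolding J_ideal_def by (rule poly_ideal_mult)

lemma J_add: "f \<in> J \<Longrightarrow> g \<in> J \<Longrightarrow> f + g \<in> J"
  unfolding J_ideal_def by (rule poly_ideal_add)

lemma J_sum: "(\<And>x. x \<in> X \<Longrightarrow> f x \<in> J) \<Longrightarrow> sum f X \<in> J"
  unfolding J_ideal_def by (rule poly_ideal_sum)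

lemma J_diff: "f \<in> J \<Longrightarrow> g \<in> J \<Longrightarrow> f - g \<in> J"
proof -
  assume fg: "f \<in> J" "g \<in> J"
  then have "- 1 * g \<in> J" by (intro J_mult poly_ring_uminus poly_ring_one)
  then show ?thesis using J_add[of f "- 1 * g"] fg by simp
qed

lemma J_subset: "J \<subseteq> poly_ring B"
proof -
  have gens: "g \<in> poly_ring B" if "g \<in> T \<union> {theta0 B \<xi> \<eta>0} \<union> theta B \<xi> \<eta> ` C" for g
    using that initial_toric_in_poly_ring
    by (auto simp: theta_eq theta0_eq intro!: poly_ring_diff linear_form_in_poly_ring)
  then show ?thesis unfolding J_ideal_def by (intro poly_ideal_subset) blast
qed

text \<open>Splitting off the ideals that contain \<open>d\<close> resp. \<open>d'\<close> from \<open>\<theta>\<^sub>c\<close> and \<open>\<theta>\<^sub>c'\<close> leaves two linear forms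
  whose product vanishes modulo the initial ideal of the toric ideal.\<close>

lemma linear_form_product_in_J:
  assumes c: "c \<in> C" "c' \<in> C"
    and inc: "\<And>\<alpha> \<beta>. \<alpha> \<in> B \<Longrightarrow> c \<in> \<alpha> \<Longrightarrow> d \<notin> \<alpha> \<Longrightarrow> \<beta> \<in> B \<Longrightarrow> c' \<in> \<beta> \<Longrightarrow> d' \<notin> \<beta> \<Longrightarrow> Var \<alpha> * Var \<beta> \<in> J"
  shows "(linear_form \<xi> {\<alpha>\<in>B. c \<in> \<alpha> \<and> d \<in> \<alpha>} - Const (\<eta> c)) *
    (linear_form \<xi> {\<alpha>\<in>B. c' \<in> \<alpha> \<and> d' \<in> \<alpha>} - Const (\<eta> c')) \<in> J"
proof -
  let ?t = "theta B \<xi> \<eta> c" and ?t' = "theta B \<xi> \<eta> c'"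
  let ?U = "{\<alpha>\<in>B. c \<in> \<alpha> \<and> d \<notin> \<alpha>}" and ?U' = "{\<alpha>\<in>B. c' \<in> \<alpha> \<and> d' \<notin> \<alpha>}"
  let ?u = "linear_form \<xi> ?U" and ?u' = "linear_form \<xi> ?U'"
  have split: "linear_form \<xi> {\<alpha>\<in>B. e \<in> \<alpha>} = linear_form \<xi> {\<alpha>\<in>B. e \<in> \<alpha> \<and> f \<in> \<alpha>} + linear_form \<xi> {\<alpha>\<in>B. e \<in> \<alpha> \<and> f \<notin> \<alpha>}" for e f
  proof -
    have "{\<alpha>\<in>B. e \<in> \<alpha>} = {\<alpha>\<in>B. e \<in> \<alpha> \<and> f \<in> \<alpha>} \<union> {\<alpha>\<in>B. e \<in> \<alpha> \<and> f \<notin> \<alpha>}" by auto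
    then show ?thesis
      unfolding linear_form_def using finite_B by (simp only:) (rule sum.union_disjoint, auto)
  qed
  have "?u * ?u' \<in> J"
    unfolding linear_form_def sum_product
  proof (intro J_sum)
    fix \<alpha> \<beta> assume "\<alpha> \<in> ?U" "\<beta> \<in> ?U'"
    then have "(Const (\<xi> \<alpha>) * Const (\<xi> \<beta>)) * (Var \<alpha> * Var \<beta>) \<in> J"
      by (intro J_mult poly_ring_mult poly_ring_Const inc) auto
    then show "Const (\<xi> \<alpha>) * Var \<alpha> * (Const (\<xi> \<beta>) * Var \<beta>) \<in> J" by (simp add: ac_simps)
  qed
  moreover have t: "?t \<in> J" "?t' \<in> J" using c theta_in_J by blast+
  moreover from t have "?t' - ?u' \<in> poly_ring B" "?u \<in> poly_ring B"
    using J_subset by (auto intro!: poly_ring_diff linear_form_in_poly_ring)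
  then have "(?t' - ?u') * ?t \<in> J" "?u * ?t' \<in> J" using t J_mult by blast+
  \<comment> \<open>The expansion of \<open>(?t - ?u) * (?t' - ?u')\<close>, grouped so that each
    summand is known to lie in \<open>J\<close>.\<close>
  ultimately have "(?t' - ?u') * ?t - ?u * ?t' + ?u * ?u' \<in> J" by (intro J_add J_diff)
  then have "(?t - ?u) * (?t' - ?u') \<in> J" by (simp add: algebra_simps)
  then show ?thesis
    using split[of c d] split[of c' d'] by (simp add: theta_eq algebra_simps)
qed

lemma not_standardI:
  assumes "f \<in> J" "is_initial_exponent lt f n" "Poly_Mapping.keys m \<subseteq> B"
    and "\<And>\<alpha>. Poly_Mapping.lookup n \<alpha> \<le> Poly_Mapping.lookup m \<alpha>"
  shows "Poly_Mapping.single m 1 \<in> initial_ideal B lt J"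
proof -
  have "m = (m - n) + n"
    by (rule poly_mapping_eqI) (use assms(4) in \<open>simp add: lookup_add lookup_minus\<close>)
  moreover have "Poly_Mapping.keys (m - n) \<subseteq> B"
    using assms(3) by (auto simp: in_keys_iff lookup_minus)
  ultimately show ?thesis using initial_idealI[OF assms(1,2)] by metis
qed

text \<open>The lowest pair of a column \<open>k > 0\<close> is generated by \<open>a i k\<close>,
  the leftmost pair of a row \<open>l > 0\<close> by \<open>b i l\<close>; intersecting with another
  ideal through the generator shows minimality. In column or row 0 the boundary pair is the empty
  ideal, which leads \<open>theta0\<close>.\<close>

lemma boundary_not_standard:
  assumes m: "Poly_Mapping.keys m \<subseteq> B" "al i k l \<in> Poly_Mapping.keys m"
    and i: "i \<in> I" and A: "(k, l) \<in> A i" and S: "(k, l) \<notin> S i"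
  shows "Poly_Mapping.single m 1 \<in> initial_ideal B lt J"
proof -
  interpret tc: two_chain_poset "P i" "r i" "p i" "a i" "s i" "b i" by (rule two_chain[OF i])
  have bd: "k \<le> p i" "l \<le> s i" using tc.A_bounds A by auto
  have le: "Poly_Mapping.lookup (Poly_Mapping.single (al i k l) 1) \<alpha> \<le> Poly_Mapping.lookup m \<alpha>" for \<alpha>
    using m(2) by (auto simp: lookup_single when_def in_keys_iff)
  have theta: ?thesis if c: "c \<in> P i" "c \<in> al i k l" and min: "\<And>k' l'. (k', l') \<in> A i \<Longrightarrow> c \<in> al i k' l' \<Longrightarrow> k \<le> k' \<and> l \<le> l'" for c
  proof -
    have "(\<alpha>, al i k l) \<in> lt" if \<alpha>: "\<alpha> \<in> {\<alpha>\<in>B. c \<in> \<alpha>}" "\<alpha> \<noteq> al i k l" for \<alpha>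
    proof -
      have "\<alpha> \<in> L i" using \<alpha> c B_in_L i by blast
      then obtain k' l' where kl: "(k', l') \<in> A i" "\<alpha> = al i k' l'" by (rule tc.ideal_eq_alpha)
      then have "al i k l \<subset> \<alpha>" using \<alpha> min[of k' l'] tc.alpha_mono[of k k' l l'] by auto
      then show ?thesis using compatible[OF i \<open>\<alpha> \<in> L i\<close> al_in_L[OF A]] by blast
    qed
    then have "is_initial_exponent lt (theta B \<xi> \<eta> c) (Poly_Mapping.single (al i k l) 1)"
      unfolding theta_eq using c al_in_B[OF i A] \<xi>_nonzero by (intro is_initial_exponent_linear_form) auto
    then show ?thesis using not_standardI[OF theta_in_J _ m(1) le] c i by blast
  qed
  have empty: ?thesis if "k = 0" "l = 0"
  proof -
    have al: "al i k l = {}" using that by (simp add: alpha_def)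
    have "is_initial_exponent lt (theta0 B \<xi> \<eta>0) (Poly_Mapping.single (al i k l) 1)"
      unfolding theta0_eq al using empty_in_B \<xi>_nonzero lt_empty by (intro is_initial_exponent_linear_form) auto
    then show ?thesis using not_standardI[OF theta0_in_J _ m(1) le] by blast
  qed
  have "l = l_sharp (A i) k \<or> k = k_flat (A i) l"
    using S A bd by (auto simp: S_pairs_def Let_def)
  then show ?thesis
  proof
    assume l: "l = l_sharp (A i) k"
    show ?thesis
    proof (cases "k = 0")
      case True
      then show ?thesis using l tc.ls_zero empty by simp
    next
      case False
      show ?thesis
      proof (rule theta)
        show "a i k \<in> P i" using tc.a_in[of k] False bd by simp
        show "a i k \<in> al i k l" using tc.a_mem_alpha[of k k l] False bd by simp
        fix k' l' assume kl: "(k', l') \<in> A i" "a i k \<in> al i k' l'"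
        then have "k \<le> k'" using tc.a_mem_alpha[of k k' l'] tc.A_bounds[OF kl(1)] False bd by simp
        moreover from this have "l \<le> min l l'"
          using tc.ls_least[of k "min l l'"] tc.A_min[OF A kl(1)] l by (simp add: min_def)
        ultimately show "k \<le> k' \<and> l \<le> l'" by simp
      qed
    qed
  next
    assume k: "k = k_flat (A i) l"
    have least: "k \<le> k'" if "(k', l) \<in> A i" for k'
      unfolding k k_flat_def by (rule Least_le) (rule that)
    show ?thesis
    proof (cases "l = 0")
      case True
      then show ?thesis using least[of 0] tc.A_zero empty by simp
    next
      case False
      show ?thesis
      proof (rule theta)
        show "b i l \<in> P i" using tc.b_in[of l] False bd by simp
        show "b i l \<in> al i k l" using tc.b_mem_alpha[of l k l] False bd by simp
        fix k' l' assume kl: "(k', l') \<in> A i" "b i l \<in> al i k' l'"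
        then have "l \<le> l'" using tc.b_mem_alpha[of l k' l'] tc.A_bounds[OF kl(1)] False bd by simp
        moreover from this have "k \<le> min k k'"
          using least[of "min k k'"] tc.A_min[OF A kl(1)] by (simp add: min_def split: if_splits)
        ultimately show "k \<le> k' \<and> l \<le> l'" by simp
      qed
    qed
  qed
qed

text \<open>\<open>?f\<close> keeps the ideals containing \<open>a i k\<close> and
  \<open>b i l\<close>, whose smallest member is \<open>al i k l\<close>; likewise \<open>?g\<close>
  for \<open>(k', l')\<close>. For discarded ideals \<open>al i x y\<close> and
  \<open>al i u v\<close>, the inequalities \<open>u < k' \<le> k \<le> x\<close> and
  \<open>y < l \<le> l' \<le> v\<close> give incomparability.\<close>

lemma pair_not_standard:
  assumes m: "Poly_Mapping.keys m \<subseteq> B"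
    and i: "i \<in> I" and A1: "(k, l) \<in> A i" and A2: "(k', l') \<in> A i"
    and ord: "k' \<le> k" "l \<le> l'" and pos: "1 \<le> k" "1 \<le> l" "1 \<le> k'" "1 \<le> l'"
    and le: "\<And>\<alpha>. Poly_Mapping.lookup (Poly_Mapping.single (al i k l) 1 + Poly_Mapping.single (al i k' l') 1) \<alpha>
      \<le> Poly_Mapping.lookup m \<alpha>"
  shows "Poly_Mapping.single m 1 \<in> initial_ideal B lt J"
proof -
  interpret tc: two_chain_poset "P i" "r i" "p i" "a i" "s i" "b i" by (rule two_chain[OF i])
  have bd: "k \<le> p i" "l \<le> s i" "k' \<le> p i" "l' \<le> s i" using tc.A_bounds A1 A2 by auto
  have C: "a i k \<in> P i" "b i l' \<in> P i" using tc.a_in tc.b_in pos bd by auto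
  let ?f = "linear_form \<xi> {\<alpha>\<in>B. a i k \<in> \<alpha> \<and> b i l \<in> \<alpha>} - Const (\<eta> (a i k))"
  let ?g = "linear_form \<xi> {\<alpha>\<in>B. b i l' \<in> \<alpha> \<and> a i k' \<in> \<alpha>} - Const (\<eta> (b i l'))"
  have "?f * ?g \<in> J"
  proof (rule linear_form_product_in_J)
    show "a i k \<in> C" "b i l' \<in> C" using C i by auto
    fix \<alpha> \<beta> assume *: "\<alpha> \<in> B" "a i k \<in> \<alpha>" "b i l \<notin> \<alpha>" "\<beta> \<in> B" "b i l' \<in> \<beta>" "a i k' \<notin> \<beta>"
    have L: "\<alpha> \<in> L i" "\<beta> \<in> L i" using * C B_in_L i by blast+
    obtain x y where xy: "(x, y) \<in> A i" "\<alpha> = al i x y" using L(1) by (rule tc.ideal_eq_alpha)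
    obtain u v where uv: "(u, v) \<in> A i" "\<beta> = al i u v" using L(2) by (rule tc.ideal_eq_alpha)
    have bd': "x \<le> p i" "y \<le> s i" "u \<le> p i" "v \<le> s i" using tc.A_bounds xy(1) uv(1) by auto
    have "k \<le> x" "y < l" "l' \<le> v" "u < k'"
      using * bd bd' pos unfolding xy(2) uv(2) by (auto simp: tc.a_mem_alpha tc.b_mem_alpha)
    then have "\<not> \<alpha> \<subseteq> \<beta>" "\<not> \<beta> \<subseteq> \<alpha>"
      using tc.alpha_subset_iff bd' ord unfolding xy(2) uv(2) by auto
    then show "Var \<alpha> * Var \<beta> \<in> J" using incomparable_in_initial[OF i L] T_in_J by blast
  qed
  \<comment> \<open>Stated for the unordered set \<open>{c, d}\<close> because \<open>a\<close> and
    \<open>b\<close> exchange roles between \<open>?f\<close> and \<open>?g\<close>.\<close>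
  moreover have init: "is_initial_exponent lt (linear_form \<xi> {\<alpha>\<in>B. c \<in> \<alpha> \<and> d \<in> \<alpha>} - Const e) (Poly_Mapping.single (al i x y) 1)"
    if xy: "(x, y) \<in> A i" "{c, d} = {a i x, b i y}" "1 \<le> x" "1 \<le> y" for x y c d e
  proof (rule is_initial_exponent_linear_form)
    have bd': "x \<le> p i" "y \<le> s i" using tc.A_bounds xy(1) by auto
    have cd: "c \<in> \<alpha> \<and> d \<in> \<alpha> \<longleftrightarrow> a i x \<in> \<alpha> \<and> b i y \<in> \<alpha>" for \<alpha>
      using xy(2) by (auto simp: doubleton_eq_iff)
    show "al i x y \<in> {\<alpha>\<in>B. c \<in> \<alpha> \<and> d \<in> \<alpha>}"
      using al_in_B[OF i xy(1)] tc.a_mem_alpha[of x x y] tc.b_mem_alpha[of y x y] xy bd' cd by auto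
    show "\<xi> (al i x y) \<noteq> 0" using \<xi>_nonzero al_in_B[OF i xy(1)] by blast
    fix \<alpha> assume \<alpha>: "\<alpha> \<in> {\<alpha>\<in>B. c \<in> \<alpha> \<and> d \<in> \<alpha>}" "\<alpha> \<noteq> al i x y"
    then have \<alpha>': "\<alpha> \<in> B" "a i x \<in> \<alpha>" "b i y \<in> \<alpha>" using cd by auto
    have "a i x \<in> P i" using tc.a_in xy bd' by auto
    then have L: "\<alpha> \<in> L i" using \<alpha>' B_in_L i by blast
    then obtain u v where uv: "(u, v) \<in> A i" "\<alpha> = al i u v" by (rule tc.ideal_eq_alpha)
    have "u \<le> p i" "v \<le> s i" using tc.A_bounds uv(1) by auto
    then have "x \<le> u" "y \<le> v"
      using \<alpha>' xy bd' unfolding uv(2) by (auto simp: tc.a_mem_alpha tc.b_mem_alpha)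
    then have "al i x y \<subset> \<alpha>" using \<alpha>(2) uv(2) tc.alpha_mono[of x u y v] by auto
    then show "(\<alpha>, al i x y) \<in> lt" using compatible[OF i L al_in_L[OF xy(1)]] by blast
  qed auto
  have "is_initial_exponent lt (?f * ?g) (Poly_Mapping.single (al i k l) 1 + Poly_Mapping.single (al i k' l') 1)"
    by (intro is_initial_exponent_mult init A1 A2 pos poly_ring_diff linear_form_in_poly_ring poly_ring_Const) auto
  ultimately show ?thesis using not_standardI[OF _ _ m le] by blast
qed

subsection \<open>Squarefree monomials\<close>

text \<open>Families are extensional, so that different ones differ at some index in
  \<open>I\<close> and there are finitely many of them.\<close>

definition corner_families :: "(nat \<Rightarrow> (nat \<times> nat) set) set" where
  "corner_families = (\<Pi>\<^sub>E i\<in>I. {D. D \<subseteq> S i \<and> increasing_pairs D})"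

definition corner_ideals :: "(nat \<Rightarrow> (nat \<times> nat) set) \<Rightarrow> 'a set set" where
  "corner_ideals D = (\<Union>i\<in>I. (\<lambda>(k, l). al i k l) ` D i)"

definition corner_exponent :: "(nat \<Rightarrow> (nat \<times> nat) set) \<Rightarrow> ('a set \<Rightarrow>\<^sub>0 nat)" where
  "corner_exponent D = (\<Sum>\<alpha>\<in>corner_ideals D. Poly_Mapping.single \<alpha> 1)"

lemma S_subset_A: "i \<in> I \<Longrightarrow> S i \<subseteq> A i"
  by (rule two_chain_poset.S_pairs_subset[OF two_chain])

lemma corner_familiesD: "D \<in> corner_families \<Longrightarrow> i \<in> I \<Longrightarrow> D i \<subseteq> S i"
  "D \<in> corner_families \<Longrightarrow> i \<in> I \<Longrightarrow> increasing_pairs (D i)"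
  by (auto simp: corner_families_def PiE_def Pi_def)

lemma finite_corner_families: "finite corner_families"
  unfolding corner_families_def
proof (rule finite_PiE)
  fix i assume i: "i \<in> I"
  have "finite (S i)"
    using S_subset_A[OF i] two_chain_poset.finite_A[OF two_chain[OF i]] finite_subset by blast
  then show "finite {D. D \<subseteq> S i \<and> increasing_pairs D}" by simp
qed simp

lemma corner_ideals_subset: "D \<in> corner_families \<Longrightarrow> corner_ideals D \<subseteq> B"
proof
  fix \<alpha> assume D: "D \<in> corner_families" and "\<alpha> \<in> corner_ideals D"
  then obtain i k l where *: "i \<in> I" "(k, l) \<in> D i" "\<alpha> = al i k l"
    unfolding corner_ideals_def by (auto simp del: atLeastAtMost_iff)
  then show "\<alpha> \<in> B" using corner_familiesD(1)[OF D] S_subset_A al_in_B by blast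
qed

lemma finite_corner_ideals: "D \<in> corner_families \<Longrightarrow> finite (corner_ideals D)"
  using corner_ideals_subset finite_B finite_subset by blast

text \<open>Different posets share only the empty ideal, and pairs in \<open>S i\<close> have
  positive first coordinate. Hence all variables in the product are distinct.\<close>

lemma corner_prod:
  assumes D: "D \<in> corner_families"
  shows "(\<Prod>i\<in>I. \<Prod>(k, l)\<in>D i. Var (al i k l)) = (\<Prod>\<alpha>\<in>corner_ideals D. Var \<alpha> :: ('a set, 'k) mpoly)"
proof -
  have fin: "finite ((\<lambda>(k, l). al i k l) ` D i)" if "i \<in> I" for i
    using finite_corner_ideals[OF D] that by (auto simp: corner_ideals_def intro: finite_subset)
  have A: "(k, l) \<in> A i" if "i \<in> I" "(k, l) \<in> D i" for i k l
    using corner_familiesD(1)[OF D] S_subset_A that by blast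
  have disj: "(\<lambda>(k, l). al i k l) ` D i \<inter> (\<lambda>(k, l). al j k l) ` D j = {}"
    if ij: "i \<in> I" "j \<in> I" "i \<noteq> j" for i j
  proof (rule ccontr)
    assume "\<not> ?thesis"
    then obtain k l k' l' where kl: "(k, l) \<in> D i" "(k', l') \<in> D j" "al i k l = al j k' l'" by auto
    have "1 \<le> k" using two_chain_poset.S_pairsD(2)[OF two_chain[OF ij(1)]] corner_familiesD(1)[OF D ij(1)] kl(1) by blast
    then have "a i 1 \<in> al i k l" by (auto simp: alpha_def)
    moreover have "al i k l \<subseteq> P i" "al j k' l' \<subseteq> P j"
      using kl A ij al_in_L L_subset by blast+
    ultimately show False using kl(3) P_disjoint ij by blast
  qed
  have "(\<Prod>(k, l)\<in>D i. Var (al i k l)) = (\<Prod>\<alpha>\<in>(\<lambda>(k, l). al i k l) ` D i. Var \<alpha> :: ('a set, 'k) mpoly)"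
    if i: "i \<in> I" for i
  proof -
    interpret tc: two_chain_poset "P i" "r i" "p i" "a i" "s i" "b i" by (rule two_chain[OF i])
    have "inj_on (\<lambda>(k, l). al i k l) (D i)"
    proof (rule inj_onI, clarify)
      fix k l k' l' assume kl: "(k, l) \<in> D i" "(k', l') \<in> D i" "al i k l = al i k' l'"
      then show "k = k' \<and> l = l'"
        using tc.alpha_eq_iff[of k l k' l'] tc.A_bounds[OF A[OF i kl(1)]] tc.A_bounds[OF A[OF i kl(2)]] by simp
    qed
    then show ?thesis by (simp add: prod.reindex case_prod_unfold)
  qed
  then have "(\<Prod>i\<in>I. \<Prod>(k, l)\<in>D i. Var (al i k l)) =
      (\<Prod>i\<in>I. \<Prod>\<alpha>\<in>(\<lambda>(k, l). al i k l) ` D i. Var \<alpha> :: ('a set, 'k) mpoly)"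
    by (rule prod.cong[OF HOL.refl])
  also have "\<dots> = (\<Prod>\<alpha>\<in>corner_ideals D. Var \<alpha>)"
    unfolding corner_ideals_def by (rule prod.UNION_disjoint[symmetric]) (use fin disj in auto)
  finally show ?thesis .
qed

lemma corner_monomial:
  "D \<in> corner_families \<Longrightarrow>
    (\<Prod>\<alpha>\<in>corner_ideals D. Var \<alpha> :: ('a set, 'k) mpoly) = Poly_Mapping.single (corner_exponent D) 1"
  unfolding Var_def corner_exponent_def by (rule prod_single_one[OF finite_corner_ideals])

lemma S_monomial_products:
  "{\<Prod>i\<in>I. u i |u. \<forall>i\<in>I. u i \<in> S_monomials (P i) (r i) (p i) (a i) (s i) (b i)} =
    (\<lambda>D. \<Prod>\<alpha>\<in>corner_ideals D. Var \<alpha> :: ('a set, 'k) mpoly) ` corner_families"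
proof (intro equalityI subsetI)
  fix x :: "('a set, 'k) mpoly"
  assume "x \<in> {\<Prod>i\<in>I. u i |u. \<forall>i\<in>I. u i \<in> S_monomials (P i) (r i) (p i) (a i) (s i) (b i)}"
  then obtain u where u: "x = (\<Prod>i\<in>I. u i)"
    "\<forall>i\<in>I. u i \<in> S_monomials (P i) (r i) (p i) (a i) (s i) (b i)" by blast
  have "\<forall>i\<in>I. \<exists>D. D \<subseteq> S i \<and> increasing_pairs D \<and> u i = (\<Prod>(k, l)\<in>D. Var (al i k l))"
    using u(2) two_chain_poset.S_monomials_eq[OF two_chain] by blast
  from bchoice[OF this] obtain E where E: "\<forall>i\<in>I. E i \<subseteq> S i \<and> increasing_pairs (E i) \<and> u i = (\<Prod>(k, l)\<in>E i. Var (al i k l))"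
    ..
  let ?D = "restrict E I"
  have D: "?D \<in> corner_families" using E by (auto simp: corner_families_def)
  have "x = (\<Prod>i\<in>I. \<Prod>(k, l)\<in>?D i. Var (al i k l))"
    unfolding u(1) by (rule prod.cong) (use E in auto)
  then show "x \<in> (\<lambda>D. \<Prod>\<alpha>\<in>corner_ideals D. Var \<alpha> :: ('a set, 'k) mpoly) ` corner_families"
    using D corner_prod[OF D] by auto
next
  fix x :: "('a set, 'k) mpoly"
  assume "x \<in> (\<lambda>D. \<Prod>\<alpha>\<in>corner_ideals D. Var \<alpha> :: ('a set, 'k) mpoly) ` corner_families"
  then obtain D where D: "D \<in> corner_families" "x = (\<Prod>i\<in>I. \<Prod>(k, l)\<in>D i. Var (al i k l))"
    using corner_prod by auto
  moreover have "(\<Prod>(k, l)\<in>D i. Var (al i k l) :: ('a set, 'k) mpoly) \<in> S_monomials (P i) (r i) (p i) (a i) (s i) (b i)"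
    if "i \<in> I" for i
    using two_chain_poset.S_monomials_eq[OF two_chain[OF that]] corner_familiesD[OF D(1) that] by blast
  ultimately show "x \<in> {\<Prod>i\<in>I. u i |u. \<forall>i\<in>I. u i \<in> S_monomials (P i) (r i) (p i) (a i) (s i) (b i)}"
    by blast
qed

lemma standard_exponent_in_corners:
  assumes m: "Poly_Mapping.keys m \<subseteq> B" and std: "Poly_Mapping.single m 1 \<notin> initial_ideal B lt J"
  shows "m \<in> corner_exponent ` corner_families"
proof -
  define D where "D = (\<lambda>i\<in>I. {(k, l) \<in> A i. al i k l \<in> Poly_Mapping.keys m})"
  have D_iff: "(k, l) \<in> D i \<longleftrightarrow> (k, l) \<in> A i \<and> al i k l \<in> Poly_Mapping.keys m" if "i \<in> I" for i k l
    using that by (simp add: D_def)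
  have S: "D i \<subseteq> S i" if i: "i \<in> I" for i
  proof clarify
    fix k l assume "(k, l) \<in> D i"
    then show "(k, l) \<in> S i"
      using boundary_not_standard[OF m _ i, of k l] std D_iff[OF i] by blast
  qed
  \<comment> \<open>For two distinct ideals, occurrence in \<open>m\<close> already gives
    divisibility by their product; for equal ones the exponent must be at least 2, which is the
    assumption \<open>le\<close>.\<close>
  have pair: False
    if i: "i \<in> I" and D: "(k, l) \<in> D i" "(k', l') \<in> D i" and ord: "k' \<le> k" "l \<le> l'"
      and le: "al i k l = al i k' l' \<Longrightarrow> 2 \<le> Poly_Mapping.lookup m (al i k l)" for i k l k' l'
  proof -
    note pos = two_chain_poset.S_pairsD[OF two_chain[OF i] subsetD[OF S[OF i]]]
    have "Poly_Mapping.lookup (Poly_Mapping.single (al i k l) 1 + Poly_Mapping.single (al i k' l') 1) \<alpha>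
        \<le> Poly_Mapping.lookup m \<alpha>" for \<alpha>
      using D le by (auto simp: D_iff[OF i] lookup_add lookup_single when_def in_keys_iff)
    then show False
      using pair_not_standard[OF m i _ _ ord] pos(1,2,4)[OF D(1)] pos(1,2,4)[OF D(2)] std by blast
  qed
  have inc: "increasing_pairs (D i)" if i: "i \<in> I" for i
  proof -
    interpret tc: two_chain_poset "P i" "r i" "p i" "a i" "s i" "b i" by (rule two_chain[OF i])
    have "k = k' \<and> l = l' \<or> k < k' \<and> l < l' \<or> k' < k \<and> l' < l"
      if D: "(k, l) \<in> D i" "(k', l') \<in> D i" for k l k' l'
    proof (rule ccontr)
      assume neg: "\<not> ?thesis"
      have neq: "al i k l \<noteq> al i k' l'"
        using neg tc.alpha_eq_iff[of k l k' l'] tc.A_bounds D by (auto simp: D_iff[OF i])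
      consider "k' \<le> k" "l \<le> l'" | "k \<le> k'" "l' \<le> l" using neg by linarith
      then show False
        using pair[OF i D] pair[OF i D(2,1)] neq by cases auto
    qed
    then show ?thesis by (rule increasing_pairsI)
  qed
  have fam: "D \<in> corner_families" using S inc by (auto simp: corner_families_def D_def)
  have keys: "corner_ideals D = Poly_Mapping.keys m"
  proof
    show "corner_ideals D \<subseteq> Poly_Mapping.keys m" by (auto simp: corner_ideals_def D_iff)
    show "Poly_Mapping.keys m \<subseteq> corner_ideals D"
    proof
      fix \<alpha> assume \<alpha>: "\<alpha> \<in> Poly_Mapping.keys m"
      then obtain i k l where "i \<in> I" "(k, l) \<in> A i" "\<alpha> = al i k l" using B_cases m by blast
      then have "i \<in> I" "(k, l) \<in> D i" "\<alpha> = al i k l" using \<alpha> D_iff by auto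
      then show "\<alpha> \<in> corner_ideals D" unfolding corner_ideals_def by force
    qed
  qed
  have "Poly_Mapping.lookup (corner_exponent D) \<alpha> = Poly_Mapping.lookup m \<alpha>" for \<alpha>
  proof -
    have "Poly_Mapping.lookup (corner_exponent D) \<alpha> = (if \<alpha> \<in> Poly_Mapping.keys m then 1 else 0)"
      by (simp add: corner_exponent_def keys lookup_sum lookup_single when_def)
    moreover have "Poly_Mapping.lookup m \<alpha> = 1" if \<alpha>: "\<alpha> \<in> Poly_Mapping.keys m"
    proof -
      obtain i k l where ikl: "i \<in> I" "(k, l) \<in> A i" "\<alpha> = al i k l" using B_cases m \<alpha> by blast
      then have "(k, l) \<in> D i" using \<alpha> D_iff by auto
      \<comment> \<open>Pairing \<open>(k, l)\<close> with itself rules out squares.\<close>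
      then have "\<not> 2 \<le> Poly_Mapping.lookup m \<alpha>" using pair[OF ikl(1), of k l k l] ikl(3) by auto
      moreover have "Poly_Mapping.lookup m \<alpha> \<noteq> 0" using \<alpha> by (simp add: in_keys_iff)
      ultimately show ?thesis by linarith
    qed
    ultimately show ?thesis by (auto simp: in_keys_iff)
  qed
  then have "corner_exponent D = m" by (rule poly_mapping_eqI)
  then show ?thesis using fam by blast
qed

subsection \<open>The zeros of the ideal\<close>

abbreviation "path i \<equiv> two_chain_poset.path_ideals (P i) (r i) (p i) (a i) (s i) (b i)"

lemma path_in_L: "i \<in> I \<Longrightarrow> D \<in> corner_families \<Longrightarrow> path i (D i) \<subseteq> L i"
  using two_chain_poset.path_ideals_subset[OF two_chain] corner_familiesD by blast

lemma path_chain: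
  assumes "i \<in> I" "D \<in> corner_families" "\<alpha> \<in> path i (D i)" "\<beta> \<in> path i (D i)"
  shows "\<alpha> \<subseteq> \<beta> \<or> \<beta> \<subseteq> \<alpha>"
proof -
  obtain ws where "prefix_sets ws = path i (D i)"
    using two_chain_poset.path_linear_extension[OF two_chain[OF assms(1)] corner_familiesD[OF assms(2,1)]] by blast
  then show ?thesis using prefix_sets_chain assms by metis
qed

lemma path_weights:
  assumes i: "i \<in> I" and D: "D \<in> corner_families"
  shows "\<exists>Y. (\<forall>\<alpha>. Y \<alpha> \<noteq> 0 \<longleftrightarrow> \<alpha> \<in> path i (D i) - {{}}) \<and> (\<forall>c\<in>P i. (\<Sum>\<alpha>\<in>{\<alpha>\<in>B. c \<in> \<alpha>}. Y \<alpha>) = \<eta> c)"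
proof -
  obtain ws where ws: "distinct ws" "set ws = P i" "prefix_sets ws = path i (D i)"
    using two_chain_poset.path_linear_extension[OF two_chain[OF i] corner_familiesD[OF D i]] by blast
  have "inj_on \<eta> (set ws)" "\<And>c. c \<in> set ws \<Longrightarrow> \<eta> c \<noteq> 0"
    using inj_on_subset[OF \<eta>_inj] \<eta>_nonzero i ws(2) by blast+
  from prefix_weights[OF ws(1) this] obtain Y where Y:
    "(ws \<noteq> [] \<longrightarrow> Y (set ws) = \<eta> (last ws)) \<and> (\<forall>\<alpha>. Y \<alpha> \<noteq> 0 \<longleftrightarrow> \<alpha> \<in> prefix_sets ws - {{}}) \<and>
    (\<forall>X. finite X \<longrightarrow> prefix_sets ws \<subseteq> X \<longrightarrow> (\<forall>c\<in>set ws. (\<Sum>\<alpha>\<in>{\<alpha>\<in>X. c \<in> \<alpha>}. Y \<alpha>) = \<eta> c))" ..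
  have "prefix_sets ws \<subseteq> B" using path_in_L[OF i D] L_in_B[OF i] ws(3) by blast
  then show ?thesis using Y finite_B ws by (intro exI[of _ Y]) auto
qed

text \<open>The equations \<open>theta c\<close> are solved poset by poset with the weights of the
  chosen chain. The coordinate at the empty ideal is dictated by \<open>theta0\<close>, so the claim
  on the support excludes it.\<close>

lemma zero_exists:
  assumes D: "D \<in> corner_families"
  shows "\<exists>z. (\<forall>i\<in>I. \<forall>\<alpha>\<in>L i. \<alpha> \<noteq> {} \<longrightarrow> (z \<alpha> \<noteq> 0 \<longleftrightarrow> \<alpha> \<in> path i (D i))) \<and>
    eval_mpoly (\<lambda>x. x) z (theta0 B \<xi> \<eta>0) = 0 \<and> (\<forall>c\<in>C. eval_mpoly (\<lambda>x. x) z (theta B \<xi> \<eta> c) = 0)"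
proof -
  have "\<forall>i\<in>I. \<exists>Y. (\<forall>\<alpha>. Y \<alpha> \<noteq> 0 \<longleftrightarrow> \<alpha> \<in> path i (D i) - {{}}) \<and> (\<forall>c\<in>P i. (\<Sum>\<alpha>\<in>{\<alpha>\<in>B. c \<in> \<alpha>}. Y \<alpha>) = \<eta> c)"
    using path_weights D by blast
  from bchoice[OF this] obtain Y where Y: "\<forall>i\<in>I. (\<forall>\<alpha>. Y i \<alpha> \<noteq> 0 \<longleftrightarrow> \<alpha> \<in> path i (D i) - {{}}) \<and>
      (\<forall>c\<in>P i. (\<Sum>\<alpha>\<in>{\<alpha>\<in>B. c \<in> \<alpha>}. Y i \<alpha>) = \<eta> c)"
    ..
  define W where "W \<alpha> = (\<Sum>i\<in>I. Y i \<alpha>)" for \<alpha>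
  have W: "W \<alpha> = Y i \<alpha>" if i: "i \<in> I" and c: "c \<in> P i" "c \<in> \<alpha>" for i c \<alpha>
  proof -
    have "Y j \<alpha> = 0" if j: "j \<in> I" "j \<noteq> i" for j
    proof (rule ccontr)
      assume "Y j \<alpha> \<noteq> 0"
      then have "\<alpha> \<in> path j (D j)" using bspec[OF Y j(1)] by simp
      then have "\<alpha> \<subseteq> P j" using path_in_L[OF j(1) D] L_subset by blast
      then show False using c P_disjoint i j by blast
    qed
    then have "W \<alpha> = (\<Sum>j\<in>{i}. Y j \<alpha>)"
      unfolding W_def using i by (intro sum.mono_neutral_right) auto
    then show ?thesis by simp
  qed
  \<comment> \<open>Division by \<xi> turns weights into coordinates. The empty ideal contains no
    \<open>c\<close>, so its coordinate is free to satisfy \<open>theta0\<close>.\<close>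
  define z where "z \<alpha> = (if \<alpha> = {} then \<eta>0 - (\<Sum>\<beta>\<in>B - {{}}. W \<beta>) else W \<alpha>) / \<xi> \<alpha>" for \<alpha>
  have z: "\<xi> \<alpha> * z \<alpha> = W \<alpha>" if "\<alpha> \<in> B" "\<alpha> \<noteq> {}" for \<alpha>
    using that \<xi>_nonzero by (simp add: z_def)
  have "eval_mpoly (\<lambda>x. x) z (theta0 B \<xi> \<eta>0) = 0"
  proof -
    have "(\<Sum>\<alpha>\<in>B. \<xi> \<alpha> * z \<alpha>) = \<xi> {} * z {} + (\<Sum>\<alpha>\<in>B - {{}}. W \<alpha>)"
      using finite_B empty_in_B z by (simp add: sum.remove)
    also have "\<dots> = \<eta>0" using \<xi>_nonzero[OF empty_in_B] by (simp add: z_def)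
    finally show ?thesis by (simp add: theta0_eq eval_linear_form)
  qed
  moreover have "eval_mpoly (\<lambda>x. x) z (theta B \<xi> \<eta> c) = 0" if c: "c \<in> C" for c
  proof -
    obtain i where i: "i \<in> I" "c \<in> P i" using c by blast
    have "(\<Sum>\<alpha>\<in>{\<alpha>\<in>B. c \<in> \<alpha>}. \<xi> \<alpha> * z \<alpha>) = (\<Sum>\<alpha>\<in>{\<alpha>\<in>B. c \<in> \<alpha>}. Y i \<alpha>)"
    proof (rule sum.cong[OF HOL.refl])
      fix \<alpha> assume "\<alpha> \<in> {\<alpha>\<in>B. c \<in> \<alpha>}"
      then show "\<xi> \<alpha> * z \<alpha> = Y i \<alpha>" using z[of \<alpha>] W[OF i, of \<alpha>] by auto
    qed
    then show ?thesis using bspec[OF Y i(1)] i(2) by (simp add: theta_eq eval_linear_form)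
  qed
  moreover have "z \<alpha> \<noteq> 0 \<longleftrightarrow> \<alpha> \<in> path i (D i)" if i: "i \<in> I" and \<alpha>: "\<alpha> \<in> L i" "\<alpha> \<noteq> {}" for i \<alpha>
  proof -
    obtain c where "c \<in> \<alpha>" "c \<in> P i" using \<alpha> L_subset by blast
    then have "z \<alpha> = Y i \<alpha> / \<xi> \<alpha>" using W[OF i] \<alpha> by (simp add: z_def)
    then show ?thesis using bspec[OF Y i] \<alpha> \<xi>_nonzero[OF L_in_B[OF i \<alpha>(1)]] by simp
  qed
  ultimately show ?thesis by blast
qed

text \<open>The count is applied with \<open>Z = corner_families\<close>, each family indexing one
  chosen zero, and with the corner exponents as \<open>M\<close>.\<close>

lemma standard_exponents:
  "{m. Poly_Mapping.keys m \<subseteq> B \<and> Poly_Mapping.single m 1 \<notin> initial_ideal B lt J} =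
    corner_exponent ` corner_families"
proof -
  have "\<forall>D\<in>corner_families. \<exists>z. (\<forall>i\<in>I. \<forall>\<alpha>\<in>L i. \<alpha> \<noteq> {} \<longrightarrow> (z \<alpha> \<noteq> 0 \<longleftrightarrow> \<alpha> \<in> path i (D i))) \<and>
    eval_mpoly (\<lambda>x. x) z (theta0 B \<xi> \<eta>0) = 0 \<and> (\<forall>c\<in>C. eval_mpoly (\<lambda>x. x) z (theta B \<xi> \<eta> c) = 0)"
    using zero_exists by blast
  from bchoice[OF this] obtain z where z: "\<forall>D\<in>corner_families. (\<forall>i\<in>I. \<forall>\<alpha>\<in>L i. \<alpha> \<noteq> {} \<longrightarrow> (z D \<alpha> \<noteq> 0 \<longleftrightarrow> \<alpha> \<in> path i (D i))) \<and>
    eval_mpoly (\<lambda>x. x) (z D) (theta0 B \<xi> \<eta>0) = 0 \<and> (\<forall>c\<in>C. eval_mpoly (\<lambda>x. x) (z D) (theta B \<xi> \<eta> c) = 0)"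
    ..
  have supp: "z D \<alpha> \<noteq> 0 \<longleftrightarrow> \<alpha> \<in> path i (D i)"
    if "D \<in> corner_families" "i \<in> I" "\<alpha> \<in> L i" "\<alpha> \<noteq> {}" for D i \<alpha>
    using z that by blast
  show ?thesis
  proof (rule standard_exponents_eq[OF J_subset])
    fix f D assume f: "f \<in> J" and D: "D \<in> corner_families"
    \<comment> \<open>Every term of \<open>g\<close> contains two incomparable, hence nonempty,
      ideals of one poset; at most one lies on the chosen chain, so the other coordinate is
      0.\<close>
    have T: "eval_mpoly (\<lambda>x. x) (z D) g = 0" if g: "g \<in> T" for g
    proof -
      have "mon_eval (z D) m = 0" if m: "m \<in> Poly_Mapping.keys g" for m
      proof -
        obtain h n k where h: "h \<in> (toric_ideal B :: ('a set, 'k) mpoly set)" "is_initial_exponent lt h n" "m = k + n"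
          using keys_initial_ideal[OF g m] by blast
        then obtain i \<alpha> \<beta> where *: "i \<in> I" "\<alpha> \<in> L i" "\<beta> \<in> L i" "\<alpha> \<in> Poly_Mapping.keys n" "\<beta> \<in> Poly_Mapping.keys n"
          "\<not> \<alpha> \<subseteq> \<beta>" "\<not> \<beta> \<subseteq> \<alpha>"
          using initial_exponent_toric[OF h(1,2)] by blast
        have "z D \<alpha> = 0 \<or> z D \<beta> = 0"
          using path_chain[OF *(1) D, of \<alpha> \<beta>] supp[OF D *(1)] * by blast
        moreover have "\<alpha> \<in> Poly_Mapping.keys m" "\<beta> \<in> Poly_Mapping.keys m"
          using * h(3) by (auto simp: in_keys_iff lookup_add)
        ultimately show ?thesis using mon_eval_eq_0[of \<alpha> m "z D"] mon_eval_eq_0[of \<beta> m "z D"] by blast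
      qed
      then show ?thesis by (simp add: eval_mpoly_def mon_eval_def[symmetric])
    qed
    show "eval_mpoly (\<lambda>x. x) (z D) f = 0"
      using f unfolding J_ideal_def
    proof (rule eval_mpoly_ideal_gen)
      fix g assume "g \<in> T \<union> {theta0 B \<xi> \<eta>0} \<union> theta B \<xi> \<eta> ` C"
      then show "eval_mpoly (\<lambda>x. x) (z D) g = 0" using T bspec[OF z D] by blast
    qed
  next
    fix D E assume D: "D \<in> corner_families" and E: "E \<in> corner_families" and "D \<noteq> E"
    then obtain i where i: "i \<in> I" "D i \<noteq> E i"
      unfolding corner_families_def using PiE_ext[of D I _ E] by blast
    have "path i (D i) \<noteq> path i (E i)"
      using two_chain_poset.path_ideals_inj[OF two_chain[OF i(1)] corner_familiesD[OF D i(1)] corner_familiesD[OF E i(1)]] i(2)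
      by blast
    \<comment> \<open>All paths contain the empty ideal, so different paths differ at a nonempty
      ideal, where the support of the zeros is prescribed.\<close>
    moreover have "{} \<in> path i (F i)" if F: "F \<in> corner_families" for F
    proof -
      obtain ws where "prefix_sets ws = path i (F i)"
        using two_chain_poset.path_linear_extension[OF two_chain[OF i(1)] corner_familiesD[OF F i(1)]] by blast
      moreover have "{} \<in> prefix_sets ws" by (auto simp: prefix_sets_def image_iff intro!: bexI[of _ 0])
      ultimately show ?thesis by simp
    qed
    ultimately obtain \<alpha> where \<alpha>: "\<alpha> \<noteq> {}" "\<alpha> \<in> path i (D i) \<longleftrightarrow> \<alpha> \<notin> path i (E i)"
      using D E by (metis subsetI subset_antisym)
    then have "\<alpha> \<in> L i" using path_in_L[OF i(1)] D E by blast
    then show "\<exists>\<alpha>\<in>B. z D \<alpha> \<noteq> z E \<alpha>"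
      using supp[OF D i(1) _ \<alpha>(1)] supp[OF E i(1) _ \<alpha>(1)] \<alpha>(2) L_in_B[OF i(1)] by metis
  qed (use standard_exponent_in_corners finite_corner_families card_image_le in auto)
qed

lemma standard_monomials_J:
  "standard_monomials B lt J = (\<lambda>D. \<Prod>\<alpha>\<in>corner_ideals D. Var \<alpha>) ` corner_families"
proof -
  have "standard_monomials B lt J = (\<lambda>m. Poly_Mapping.single m 1) `
      {m. Poly_Mapping.keys m \<subseteq> B \<and> Poly_Mapping.single m 1 \<notin> initial_ideal B lt J}"
    by (auto simp: standard_monomials_def monomials_def)
  also have "\<dots> = (\<lambda>D. Poly_Mapping.single (corner_exponent D) 1) ` corner_families"
    unfolding standard_exponents by (simp add: image_image)
  also have "\<dots> = (\<lambda>D. \<Prod>\<alpha>\<in>corner_ideals D. Var \<alpha>) ` corner_families"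
    by (rule image_cong) (simp_all add: corner_monomial)
  finally show ?thesis .
qed

end

theorem theorem6:
  fixes q :: nat
    and P :: "nat \<Rightarrow> 'a set" and r :: "nat \<Rightarrow> 'a rel"
    and p s :: "nat \<Rightarrow> nat" and a b :: "nat \<Rightarrow> nat \<Rightarrow> 'a"
    and \<iota> :: "complex \<Rightarrow> 'k::field"
    and \<xi> :: "'a set \<Rightarrow> 'k" and \<eta> :: "'a \<Rightarrow> 'k" and \<eta>0 :: 'k
    and lt :: "'a set rel"
  assumes "1 \<le> q"
    and "\<And>i. i \<in> {1..q} \<Longrightarrow> partial_order_on (P i) (r i)"
    and "disjoint_family_on P {1..q}"
    and "\<And>i. i \<in> {1..q} \<Longrightarrow> 1 \<le> p i \<and> 1 \<le> s i"
    and "\<And>i. i \<in> {1..q} \<Longrightarrow> two_chains (P i) (r i) (p i) (a i) (s i) (b i)"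
    and "rational_function_field \<iota> (indets (bouquet q P r) (\<Union>i\<in>{1..q}. P i)) (case_indet \<xi> \<eta> \<eta>0)"
    and "strict_linear_order_on (bouquet q P r) lt"
    and "\<And>i \<alpha> \<beta>. \<lbrakk>i \<in> {1..q}; \<alpha> \<in> poset_ideals (P i) (r i); \<beta> \<in> poset_ideals (P i) (r i); \<beta> \<subset> \<alpha>\<rbrakk>
           \<Longrightarrow> (\<alpha>, \<beta>) \<in> lt"
  shows "standard_monomials (bouquet q P r) lt
           (J_ideal (bouquet q P r) (\<Union>i\<in>{1..q}. P i) lt \<xi> \<eta> \<eta>0) =
         {\<Prod>i\<in>{1..q}. u i |u. \<forall>i\<in>{1..q}. u i \<in> S_monomials (P i) (r i) (p i) (a i) (s i) (b i)}
       \<and> {\<Prod>i\<in>{1..q}. u i |u. \<forall>i\<in>{1..q}. u i \<in> S_monomials (P i) (r i) (p i) (a i) (s i) (b i)}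
         \<subseteq> (squarefree_monomials (bouquet q P r) :: ('a set, 'k) mpoly set)"
proof -
  interpret two_chain_bouquet q P r p s a b \<iota> \<xi> \<eta> \<eta>0 lt
    by (rule two_chain_bouquet.intro) (use assms in blast)+
  show ?thesis
    unfolding S_monomial_products standard_monomials_J squarefree_monomials_def
    using corner_ideals_subset finite_corner_ideals by blast
qed

end
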